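(* For any values $\eta,\mu,\nu>0$ satisfying $$\mu\ge \tfrac43\eta,\qquad \nu=\Big(\tfrac1{3\eta}-\tfrac1{9\mu}\Big)^{-1},$$ there is always a range of Lax shocks that have either an oscillatory dissipative shock profile, i.e. a profile that is not componentwise monotone in any variables, or no dissipative shock profile at all.
   Context: Minkowski metric $g=\mathrm{diag}(-1,1,1,1)$; indices run over $0,\dots,3$, are raised and lowered with $g$, and repeated indices are summed. The state is $\psi^\gamma=u^\gamma/\theta$ with temperature $\theta=(-\psi_\gamma\psi^\gamma)^{-1/2}>0$ and four-velocity $u^\gamma=\theta\psi^\gamma$, $u^0>0$, $u_\gamma u^\gamma=-1$. Ideal energy-momentum tensor: $T^{\alpha\beta}=\theta^3p'(\theta)\psi^\alpha\psi^\beta+p(\theta)g^{\alpha\beta}$ with $p(\theta)=\frac13\theta^4$. Dissipation: $\Delta T^{\alpha\beta}=-B^{\alpha\beta\gamma\delta}(\psi)\,\partial\psi_\gamma/\partial x^\delta$, $B^{\alpha\beta\gamma\delta}=\eta B_{visc}^{\alpha\beta\gamma\delta}-\mu B_1^{\alpha\beta\gamma\delta}-\nu B_2^{\alpha\beta\gamma\delta}$ with parameters $\eta,\mu,\nu>0$, where $\Pi^{\alpha\beta}=u^\alpha u^\beta+g^{\alpha\beta}$ and $$B_{visc}^{\alpha\beta\gamma\delta}=\Pi^{\alpha\gamma}\Pi^{\beta\delta}+\Pi^{\alpha\delta}\Pi^{\beta\gamma}-\tfrac23\Pi^{\alpha\beta}\Pi^{\gamma\delta},$$ $$B_1^{\alpha\beta\gamma\delta}=(3u^\alpha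 u^\beta+\Pi^{\alpha\beta})(3u^\gamma u^\delta+\Pi^{\gamma\delta}),$$ $$B_2^{\alpha\beta\gamma\delta}=(u^\alpha{\Pi^\beta}_\epsilon+u^\beta{\Pi^\alpha}_\epsilon)(u^\gamma\Pi^{\delta\epsilon}+u^\delta\Pi^{\gamma\epsilon}).$$ The dissipative model is $\partial_\beta(T^{\alpha\beta}+\Delta T^{\alpha\beta})=0$; the Euler equations are $\partial_\beta T^{\alpha\beta}=0$. Shock waves are discontinuous solutions of the Euler equations equal to a constant state $\psi_-$ for $x^\beta\xi_\beta<0$ and $\psi_+$ for $x^\beta\xi_\beta>0$, with $\xi^\beta\xi_\beta=1$. They are taken to be standing with $(\xi_0,\xi_1,\xi_2,\xi_3)=(0,1,0,0)$ (no loss of generality by Lorentz invariance and isotropy), and only states with $\psi^2=\psi^3=0$ are considered, so the state space is $\Psi=\{(\psi^0,\psi^1)\in\mathbb R^2:\psi^0>|\psi^1|\}$ and below indices run over $0,1$. Write $(u,v)=(u^0,u^1)$, $u^2=1+v^2$. A standing Lax shock is a pair $\psi_-\ne\psi_+$ in $\Psi$ satisfying the Rankine–Hugoniot conditions $T^{\alpha1}(\psi_-)=T^{\alpha1}(\psi_+)=:q^\alpha$, $\alpha=0,1$, and the Lax entropy conditions: with $w=v/u$, $c=1/\sqrt3$ and characteristic speeds $\lambda_1=\frac{w-c}{1-wc}<\lambda_2=\frac{w+c}{1+wc}$ of the planar Euler equations, either $\lambda_1(\psi_-)>0>\lambda_1(\psi_+)$ and $\lambda_2(\psi_+)>0$,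 or $\lambda_2(\psi_-)>0>\lambda_2(\psi_+)$ and $\lambda_1(\psi_-)<0$. A dissipative shock profile (or just profile) of $(\psi_-,\psi_+)$ is a solution $\tilde\psi:\mathbb R\to\Psi$ of $$B^{\alpha1\gamma1}(\tilde\psi)\,\tilde\psi_\gamma'=T^{\alpha1}(\tilde\psi)-q^\alpha\ (\alpha=0,1),\qquad \lim_{z\to\pm\infty}\tilde\psi(z)=\psi_\pm ;$$ equivalently, $\psi(x)=\tilde\psi(x^\beta\xi_\beta)$ solves the dissipative model and connects $\psi_-$ to $\psi_+$. *)

theory Defs
  imports "HOL-Analysis.Analysis"
begin

text \<open>
  Tensors are functions of indices of type \<open>nat\<close>, which range over \<open>0, \<dots>, 3\<close>; all arguments of
  tensors are contravariant unless stated otherwise, and the covariant form of a vector is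
  written with \<open>lower\<close>.
\<close>

definition minkowski :: "nat \<Rightarrow> nat \<Rightarrow> real" where
  "minkowski \<alpha> \<beta> = (if \<alpha> \<noteq> \<beta> then 0 else if \<alpha> = 0 then - 1 else 1)"

text \<open>\<open>minkowski\<close> is its own inverse, so it serves both as $g_{\alpha\beta}$ and as
  $g^{\alpha\beta}$.\<close>

definition lower :: "(nat \<Rightarrow> real) \<Rightarrow> nat \<Rightarrow> real" where
  "lower x \<gamma> = (\<Sum>\<delta><4. minkowski \<gamma> \<delta> * x \<delta>)"

text \<open>A pair stands for the four-vector with these components $0, 1$ and with vanishing
  components $2, 3$.\<close>

type_synonym state = "real \<times> real"

definition four :: "state \<Rightarrow> nat \<Rightarrow> real" where
  "four \<psi> \<gamma> = (if \<gamma> = 0 then fst \<psi> else if \<gamma> = 1 then snd \<psi> else 0)"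

definition state_space :: "state set" where
  "state_space = {\<psi>. fst \<psi> > \<bar>snd \<psi>\<bar>}"

definition temperature :: "state \<Rightarrow> real" where
  "temperature \<psi> = (- (\<Sum>\<gamma><4. lower (four \<psi>) \<gamma> * four \<psi> \<gamma>)) powr (- 1 / 2)"

definition velocity :: "state \<Rightarrow> nat \<Rightarrow> real" where
  "velocity \<psi> \<gamma> = temperature \<psi> * four \<psi> \<gamma>"

definition pressure :: "real \<Rightarrow> real" where
  "pressure \<theta> = 1 / 3 * \<theta> ^ 4"

definition ideal_tensor :: "state \<Rightarrow> nat \<Rightarrow> nat \<Rightarrow> real" where
  "ideal_tensor \<psi> \<alpha> \<beta> =
     temperature \<psi> ^ 3 * deriv pressure (temperature \<psi>) * four \<psi> \<alpha> * four \<psi> \<beta>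
     + pressure (temperature \<psi>) * minkowski \<alpha> \<beta>"

definition proj :: "state \<Rightarrow> nat \<Rightarrow> nat \<Rightarrow> real" where
  "proj \<psi> \<alpha> \<beta> = velocity \<psi> \<alpha> * velocity \<psi> \<beta> + minkowski \<alpha> \<beta>"

text \<open>The mixed form ${\Pi^\beta}_\epsilon$.\<close>

definition proj_mixed :: "state \<Rightarrow> nat \<Rightarrow> nat \<Rightarrow> real" where
  "proj_mixed \<psi> \<beta> \<epsilon> = lower (proj \<psi> \<beta>) \<epsilon>"

definition B_visc :: "state \<Rightarrow> nat \<Rightarrow> nat \<Rightarrow> nat \<Rightarrow> nat \<Rightarrow> real" where
  "B_visc \<psi> \<alpha> \<beta> \<gamma> \<delta> =
     proj \<psi> \<alpha> \<gamma> * proj \<psi> \<beta> \<delta> + proj \<psi> \<alpha> \<delta> * proj \<psi> \<beta> \<gamma>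
     - 2 / 3 * proj \<psi> \<alpha> \<beta> * proj \<psi> \<gamma> \<delta>"

definition B_one :: "state \<Rightarrow> nat \<Rightarrow> nat \<Rightarrow> nat \<Rightarrow> nat \<Rightarrow> real" where
  "B_one \<psi> \<alpha> \<beta> \<gamma> \<delta> =
     (3 * velocity \<psi> \<alpha> * velocity \<psi> \<beta> + proj \<psi> \<alpha> \<beta>)
     * (3 * velocity \<psi> \<gamma> * velocity \<psi> \<delta> + proj \<psi> \<gamma> \<delta>)"

definition B_two :: "state \<Rightarrow> nat \<Rightarrow> nat \<Rightarrow> nat \<Rightarrow> nat \<Rightarrow> real" where
  "B_two \<psi> \<alpha> \<beta> \<gamma> \<delta> =
     (\<Sum>\<epsilon><4. (velocity \<psi> \<alpha> * proj_mixed \<psi> \<beta> \<epsilon> + velocity \<psi> \<beta> * proj_mixed \<psi> \<alpha> \<epsilon>)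
           * (velocity \<psi> \<gamma> * proj \<psi> \<delta> \<epsilon> + velocity \<psi> \<delta> * proj \<psi> \<gamma> \<epsilon>))"

definition B_diss :: "real \<Rightarrow> real \<Rightarrow> real \<Rightarrow> state \<Rightarrow> nat \<Rightarrow> nat \<Rightarrow> nat \<Rightarrow> nat \<Rightarrow> real" where
  "B_diss \<eta> \<mu> \<nu> \<psi> \<alpha> \<beta> \<gamma> \<delta> =
     \<eta> * B_visc \<psi> \<alpha> \<beta> \<gamma> \<delta> - \<mu> * B_one \<psi> \<alpha> \<beta> \<gamma> \<delta> - \<nu> * B_two \<psi> \<alpha> \<beta> \<gamma> \<delta>"

definition sound_speed :: real where
  "sound_speed = 1 / sqrt 3"

definition fluid_speed :: "state \<Rightarrow> real" where
  "fluid_speed \<psi> = velocity \<psi> 1 / velocity \<psi> 0"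

definition char_speed1 :: "state \<Rightarrow> real" where
  "char_speed1 \<psi> = (fluid_speed \<psi> - sound_speed) / (1 - fluid_speed \<psi> * sound_speed)"

definition char_speed2 :: "state \<Rightarrow> real" where
  "char_speed2 \<psi> = (fluid_speed \<psi> + sound_speed) / (1 + fluid_speed \<psi> * sound_speed)"

definition rankine_hugoniot :: "state \<Rightarrow> state \<Rightarrow> bool" where
  "rankine_hugoniot \<psi>m \<psi>p \<longleftrightarrow> (\<forall>\<alpha><2. ideal_tensor \<psi>m \<alpha> 1 = ideal_tensor \<psi>p \<alpha> 1)"

definition lax_entropy :: "state \<Rightarrow> state \<Rightarrow> bool" where
  "lax_entropy \<psi>m \<psi>p \<longleftrightarrow>
     char_speed1 \<psi>m > 0 \<and> 0 > char_speed1 \<psi>p \<and> char_speed2 \<psi>p > 0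
     \<or> char_speed2 \<psi>m > 0 \<and> 0 > char_speed2 \<psi>p \<and> char_speed1 \<psi>m < 0"

definition lax_shocks :: "(state \<times> state) set" where
  "lax_shocks = {(\<psi>m, \<psi>p). \<psi>m \<in> state_space \<and> \<psi>p \<in> state_space \<and> \<psi>m \<noteq> \<psi>p
     \<and> rankine_hugoniot \<psi>m \<psi>p \<and> lax_entropy \<psi>m \<psi>p}"

text \<open>The constants $q^\alpha$ are the values of $T^{\alpha 1}$ at the left state; for a shock they
  agree with those at the right state.\<close>

definition shock_profile ::
  "real \<Rightarrow> real \<Rightarrow> real \<Rightarrow> state \<Rightarrow> state \<Rightarrow> (real \<Rightarrow> state) \<Rightarrow> bool" where
  "shock_profile \<eta> \<mu> \<nu> \<psi>m \<psi>p \<phi> \<longleftrightarrow>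
     (\<forall>z. \<phi> z \<in> state_space) \<and>
     (\<forall>z. \<exists>d. (\<phi> has_vector_derivative d) (at z) \<and>
        (\<forall>\<alpha><2. (\<Sum>\<gamma><2. B_diss \<eta> \<mu> \<nu> (\<phi> z) \<alpha> 1 \<gamma> 1 * lower (four d) \<gamma>)
               = ideal_tensor (\<phi> z) \<alpha> 1 - ideal_tensor \<psi>m \<alpha> 1)) \<and>
     (\<phi> \<longlongrightarrow> \<psi>m) at_bot \<and> (\<phi> \<longlongrightarrow> \<psi>p) at_top"

text \<open>State variables: a $C^1$ diffeomorphism of the state space onto its image. Differentiability
  matters, since homeomorphisms can turn a spiral into a non-oscillating curve.\<close>

definition state_variables :: "(state \<Rightarrow> real \<times> real) \<Rightarrow> bool" where
  "state_variables V \<longleftrightarrow> inj_on V state_space \<and>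
     (\<exists>V' :: state \<Rightarrow> (state \<Rightarrow>\<^sub>L (real \<times> real)). continuous_on state_space V' \<and>
        (\<forall>\<psi>\<in>state_space. (V has_derivative blinfun_apply (V' \<psi>)) (at \<psi>) \<and>
                          bij (blinfun_apply (V' \<psi>))))"

definition monotone_function :: "(real \<Rightarrow> real) \<Rightarrow> bool" where
  "monotone_function f \<longleftrightarrow> mono f \<or> antimono f"

text \<open>Whatever variables are used to describe the states, none of the two components is monotone
  along the curve.\<close>

definition oscillatory :: "(real \<Rightarrow> state) \<Rightarrow> bool" where
  "oscillatory \<phi> \<longleftrightarrow> (\<forall>V. state_variables V \<longrightarrow>
     \<not> monotone_function (\<lambda>z. fst (V (\<phi> z))) \<and> \<not> monotone_function (\<lambda>z. snd (V (\<phi> z))))"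

end

theory Submission
  imports Defs
begin

text \<open>
  Near the right state the profile equation is an autonomous planar system whose linearisation is
  $B^{-1}K$ with symmetric $B$ and $K$. If the discriminant of $\det (K - \lambda B)$ is negative, this
  rest point is a focus. For a linear functional $\ell$ and a trajectory $y$ tending to the focus,
  the quotient $\ell(Ay)/\ell(y)$ satisfies a Riccati inequality that forces blow-up in finite time, so
  $\ell(y)$ cannot keep its sign; the argument survives a $C^1$ change of variables. Hence every
  profile that ends in a focus is oscillatory.

  It remains to find one Lax shock with a negative discriminant, since this condition is open. For
  $w = v/u$ and the prescribed $\nu$ the discriminant is, up to a positive factor,
  $w^2((9\mu+3\nu)w^2-3\mu-4\eta-\nu)^2 - 4\nu(\mu-\frac43\eta-9\mu w^2)(1-w^2)(3w^2-1)$.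
  At $w^2 = (1-\epsilon)/3$ with $\epsilon = 4\eta/(3\mu+\nu)$ it is negative for all admissible
  parameters, and $1/9 < w^2 < 1/3$, so that this state is the right state of a shock whose left
  state has speed $1/(3w)$.
\<close>

subsection \<open>Trajectories at a focus\<close>

text \<open>Gronwall's argument for the squared distance \<open>Q\<close> to \<open>p\<close>: the
  linear bound on \<open>F\<close> gives |Q'| \<le> 2 C Q, so \<open>Q\<close> stays zero near each
  of its zeros. The equation is available only inside \<open>N\<close>; connectedness of the line
  (the set of times spent at \<open>p\<close> is open and closed) makes the local result
  global.\<close>

lemma rest_point_unique:
  fixes \<phi> :: "real \<Rightarrow> 'a::real_inner" and F :: "'a \<Rightarrow> 'a"
  assumes cont: "continuous_on UNIV \<phi>"
    and N: "open N" "p \<in> N"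
    and lip: "\<And>x. x \<in> N \<Longrightarrow> norm (F x) \<le> C * norm (x - p)"
    and ode: "\<And>z. \<phi> z \<in> N \<Longrightarrow> (\<phi> has_vector_derivative F (\<phi> z)) (at z)"
    and start: "\<phi> z0 = p"
  shows "\<phi> z = p"
proof -
  have "open {z. \<phi> z = p}"
    unfolding open_dist
  proof
    fix c assume "c \<in> {z. \<phi> z = p}"
    then have c: "\<phi> c = p" by simp
    have "open (\<phi> -` N)" by (rule open_vimage[OF N(1) cont])
    moreover have "c \<in> \<phi> -` N" using N(2) c by simp
    ultimately obtain e where e: "e > 0" "ball c e \<subseteq> \<phi> -` N"
      by (rule openE)
    define Q where "Q = (\<lambda>z. (\<phi> z - p) \<bullet> (\<phi> z - p))"
    have Q0: "Q z \<ge> 0" for z by (simp add: Q_def)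
    have dQ: "(Q has_real_derivative 2 * (F (\<phi> z) \<bullet> (\<phi> z - p))) (at z)" if "z \<in> ball c e" for z
    proof -
      have "(\<phi> has_vector_derivative F (\<phi> z)) (at z)" using ode that e(2) by auto
      then have "(\<phi> has_derivative (\<lambda>h. h *\<^sub>R F (\<phi> z))) (at z)"
        by (simp add: has_vector_derivative_def)
      then show ?thesis unfolding Q_def has_field_derivative_def
        by (auto intro!: derivative_eq_intros simp: inner_commute algebra_simps)
    qed
    have bd: "\<bar>2 * (F (\<phi> z) \<bullet> (\<phi> z - p))\<bar> \<le> 2 * C * Q z" if "z \<in> ball c e" for z
    proof -
      have "\<bar>F (\<phi> z) \<bullet> (\<phi> z - p)\<bar> \<le> norm (F (\<phi> z)) * norm (\<phi> z - p)"
        by (rule Cauchy_Schwarz_ineq2)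
      also have "\<dots> \<le> C * norm (\<phi> z - p) * norm (\<phi> z - p)"
        using lip[of "\<phi> z"] that e(2) by (intro mult_right_mono) auto
      also have "\<dots> = C * Q z"
        by (simp only: Q_def flip: power2_norm_eq_inner) (simp add: power2_eq_square)
      finally show ?thesis by simp
    qed
    have zero: "\<phi> z = p" if z: "z \<in> ball c e" for z
    proof -
      have "Q z = 0"
      proof (cases "z \<ge> c")
        case True
        \<comment> \<open>Forward in time the upper bound on Q' is used; the other case runs
          backward with the lower bound.\<close>
        have "exp (- (2 * C) * z) * Q z \<le> exp (- (2 * C) * c) * Q c"
        proof (rule DERIV_nonpos_imp_nonincreasing[OF True, of "\<lambda>z. exp (- (2 * C) * z) * Q z"])
          fix x assume "c \<le> x" "x \<le> z"
          then have x: "x \<in> ball c e" using z by (auto simp: dist_real_def)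
          have "((\<lambda>z. exp (- (2 * C) * z) * Q z) has_real_derivative
             exp (- (2 * C) * x) * (2 * (F (\<phi> x) \<bullet> (\<phi> x - p)) - 2 * C * Q x)) (at x)"
            by (auto intro!: derivative_eq_intros dQ[OF x] simp: algebra_simps)
          moreover have "exp (- (2 * C) * x) * (2 * (F (\<phi> x) \<bullet> (\<phi> x - p)) - 2 * C * Q x) \<le> 0"
            using bd[OF x] by (intro mult_nonneg_nonpos) auto
          ultimately show "\<exists>y. ((\<lambda>z. exp (- (2 * C) * z) * Q z) has_real_derivative y) (at x) \<and> y \<le> 0"
            by blast
        qed
        then have "exp (- (2 * C) * z) * Q z \<le> 0" by (simp add: Q_def c)
        then show ?thesis using Q0[of z] by (simp add: mult_le_0_iff)
      next
        case False
        have "exp (2 * C * z) * Q z \<le> exp (2 * C * c) * Q c"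
        proof (rule DERIV_nonneg_imp_nondecreasing[of z c "\<lambda>z. exp (2 * C * z) * Q z"])
          fix x assume "z \<le> x" "x \<le> c"
          then have x: "x \<in> ball c e" using z by (auto simp: dist_real_def)
          have "((\<lambda>z. exp (2 * C * z) * Q z) has_real_derivative
             exp (2 * C * x) * (2 * (F (\<phi> x) \<bullet> (\<phi> x - p)) + 2 * C * Q x)) (at x)"
            by (auto intro!: derivative_eq_intros dQ[OF x] simp: algebra_simps)
          moreover have "exp (2 * C * x) * (2 * (F (\<phi> x) \<bullet> (\<phi> x - p)) + 2 * C * Q x) \<ge> 0"
            using bd[OF x] by (intro mult_nonneg_nonneg) auto
          ultimately show "\<exists>y. ((\<lambda>z. exp (2 * C * z) * Q z) has_real_derivative y) (at x) \<and> 0 \<le> y"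
            by blast
        qed (use False in auto)
        then have "exp (2 * C * z) * Q z \<le> 0" by (simp add: Q_def c)
        then show ?thesis using Q0[of z] by (simp add: mult_le_0_iff)
      qed
      then show ?thesis by (simp add: Q_def)
    qed
    show "\<exists>e>0. \<forall>y. dist y c < e \<longrightarrow> y \<in> {z. \<phi> z = p}"
      using e(1) zero
      by (intro exI[of _ e] conjI allI impI) (simp_all add: dist_commute)
  qed
  moreover have "closed {z. \<phi> z = p}"
    using closed_Collect_eq[OF cont continuous_on_const] by simp
  ultimately have "{z. \<phi> z = p} = {} \<or> {z. \<phi> z = p} = UNIV"
    by (intro clopen[THEN iffD1] conjI)
  moreover have "z0 \<in> {z. \<phi> z = p}" using start by simp
  ultimately have "z \<in> {z. \<phi> z = p}" by (elim disjE) simp_all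
  then show ?thesis by simp
qed

section \<open>Rotation about a focus and real-valued observables\<close>

text \<open>The model is f' = b, b' = t b - d f. Then q = b / f solves the Riccati equation q' =
  -(q^2 - t q + d), and t^2 < 4 d keeps the right-hand side below a negative constant, so q blows up
  in finite time. Small errors relative to |f| + |b| do not change this.\<close>

lemma focus_riccati_contradiction:
  fixes f b f' b' :: "real \<Rightarrow> real"
  assumes disc: "t\<^sup>2 < 4 * d"
    and nz: "\<And>z. z \<ge> Z \<Longrightarrow> f z \<noteq> 0"
    and f: "\<And>z. z \<ge> Z \<Longrightarrow> (f has_real_derivative f' z) (at z)"
    and b: "\<And>z. z \<ge> Z \<Longrightarrow> (b has_real_derivative b' z) (at z)"
    and f': "\<And>z. z \<ge> Z \<Longrightarrow> \<bar>f' z - b z\<bar> \<le> \<epsilon> * (\<bar>f z\<bar> + \<bar>b z\<bar>)"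
    and b': "\<And>z. z \<ge> Z \<Longrightarrow> \<bar>b' z - (t * b z - d * f z)\<bar> \<le> \<epsilon> * (\<bar>f z\<bar> + \<bar>b z\<bar>)"
    and eps: "16 * (1 + d) * \<epsilon> \<le> 4 * d - t\<^sup>2"
  shows False
proof -
  \<comment> \<open>Determinant over trace of the form y^2 - t x y + d x^2, a lower bound for its
    smaller eigenvalue. The hypothesis \<open>eps\<close> amounts to
    \<open>4 * \<epsilon> \<le> k\<close>.\<close>
  define k where "k = (4 * d - t\<^sup>2) / (4 * (1 + d))"
  have d: "d > 0" using disc zero_le_power2[of t] by linarith
  have k: "k > 0" "4 * \<epsilon> \<le> k" using disc d eps by (auto simp: k_def field_simps)
  have "4 * d - t\<^sup>2 < 4 * (1 + d)" using zero_le_power2[of t] by argo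
  then have k1: "k < 1" using d by (simp add: k_def)
  have k4: "4 * k * (1 + d) = 4 * d - t\<^sup>2" using d by (simp add: k_def field_simps)
  have form: "k * (x\<^sup>2 + y\<^sup>2) \<le> y\<^sup>2 - t * x * y + d * x\<^sup>2" for x y
  proof -
    \<comment> \<open>Completing the square in \<open>y\<close>; the choice of \<open>k\<close>
      makes the last bracket vanish.\<close>
    have "4 * (1 - k) * (y\<^sup>2 - t * x * y + d * x\<^sup>2 - k * (x\<^sup>2 + y\<^sup>2))
       = (2 * (1 - k) * y - t * x)\<^sup>2 + (2 * k * x)\<^sup>2
         + (4 * d - t\<^sup>2 - 4 * k * (1 + d)) * x\<^sup>2"
      by (simp add: power2_eq_square algebra_simps)
    also have "\<dots> \<ge> 0" using k4 by simp
    finally have "0 \<le> 4 * (1 - k) * (y\<^sup>2 - t * x * y + d * x\<^sup>2 - k * (x\<^sup>2 + y\<^sup>2))" .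
    then show ?thesis using k1 by (simp add: zero_le_mult_iff)
  qed
  txt \<open>The angle of \<open>(f, b)\<close> decreases at least at the rate \<open>k / 2\<close>, but arctan is bounded.\<close>
  define g where "g z = arctan (b z / f z) + k / 2 * z" for z
  have dec: "g z \<le> g Z" if "z \<ge> Z" for z
  proof (rule DERIV_nonpos_imp_nonincreasing[OF that])
    fix x assume "Z \<le> x"
    note nz = nz[OF this] and f = f[OF this] and b = b[OF this]
      and f' = f'[OF this] and b' = b'[OF this]
    have pos: "(f x)\<^sup>2 + (b x)\<^sup>2 > 0" using nz by (simp add: add_pos_nonneg)
    define D where "D = (b' x * f x - f' x * b x) / ((f x)\<^sup>2 + (b x)\<^sup>2)"
    have "((\<lambda>z. b z / f z) has_real_derivative (b' x * f x - f' x * b x) / (f x)\<^sup>2) (at x)"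
      using nz by (auto intro!: derivative_eq_intros f b simp: power2_eq_square mult_ac)
    then have "((\<lambda>z. arctan (b z / f z)) has_real_derivative
       inverse (1 + (b x / f x)\<^sup>2) * ((b' x * f x - f' x * b x) / (f x)\<^sup>2)) (at x)"
      by (rule DERIV_chain2[OF DERIV_arctan])
    also have "inverse (1 + (b x / f x)\<^sup>2) * ((b' x * f x - f' x * b x) / (f x)\<^sup>2) = D"
    proof -
      have "1 + (b x / f x)\<^sup>2 = ((f x)\<^sup>2 + (b x)\<^sup>2) / (f x)\<^sup>2"
        using nz by (simp add: field_simps)
      then show ?thesis using nz by (simp add: D_def)
    qed
    finally have 1: "(g has_real_derivative D + k / 2) (at x)"
      unfolding g_def [abs_def] by (rule DERIV_add) (auto intro!: derivative_eq_intros)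
    \<comment> \<open>The errors cost at most \<epsilon> (|f| + |b|)^2, hence at most half of k (f^2
      + b^2); the other half is the rate of rotation.\<close>
    have "b' x * f x - f' x * b x + (k / 2) * ((f x)\<^sup>2 + (b x)\<^sup>2) \<le> 0"
    proof -
      have "b' x * f x - f' x * b x =
          (b' x - (t * b x - d * f x)) * f x - (f' x - b x) * b x
           - ((b x)\<^sup>2 - t * f x * b x + d * (f x)\<^sup>2)"
        by (simp add: power2_eq_square algebra_simps)
      moreover have "(b' x - (t * b x - d * f x)) * f x \<le> \<epsilon> * (\<bar>f x\<bar> + \<bar>b x\<bar>) * \<bar>f x\<bar>"
        using mult_right_mono[OF b', of "\<bar>f x\<bar>"] by (simp flip: abs_mult)
      moreover have "- ((f' x - b x) * b x) \<le> \<epsilon> * (\<bar>f x\<bar> + \<bar>b x\<bar>) * \<bar>b x\<bar>"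
        using mult_right_mono[OF f', of "\<bar>b x\<bar>"] by (simp flip: abs_mult)
      moreover have "\<epsilon> * (\<bar>f x\<bar> + \<bar>b x\<bar>) * \<bar>f x\<bar> + \<epsilon> * (\<bar>f x\<bar> + \<bar>b x\<bar>) * \<bar>b x\<bar>
          = \<epsilon> * (\<bar>f x\<bar> + \<bar>b x\<bar>)\<^sup>2"
        by (simp add: power2_eq_square algebra_simps)
      moreover have "\<epsilon> * (\<bar>f x\<bar> + \<bar>b x\<bar>)\<^sup>2 \<le> (k / 4) * (\<bar>f x\<bar> + \<bar>b x\<bar>)\<^sup>2"
        using k by (intro mult_right_mono) auto
      moreover have "(k / 4) * (\<bar>f x\<bar> + \<bar>b x\<bar>)\<^sup>2 \<le> (k / 4) * (2 * ((f x)\<^sup>2 + (b x)\<^sup>2))"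
        using k zero_le_power2[of "\<bar>f x\<bar> - \<bar>b x\<bar>"]
        by (intro mult_left_mono) (auto simp: power2_eq_square algebra_simps)
      ultimately show ?thesis using form[of "f x" "b x"] by (simp add: algebra_simps)
    qed
    moreover have "D + k / 2 = (b' x * f x - f' x * b x + (k / 2) * ((f x)\<^sup>2 + (b x)\<^sup>2))
        / ((f x)\<^sup>2 + (b x)\<^sup>2)"
      using pos unfolding D_def add_divide_distrib by (simp del: distrib_left_numeral, auto)
    ultimately have 2: "D + k / 2 \<le> 0" using pos by (simp add: divide_nonpos_pos)
    show "\<exists>y. (g has_real_derivative y) (at x) \<and> y \<le> 0" using 1 2 by blast
  qed
  \<comment> \<open>By this time the linear term has grown by pi, the length of the range of
    arctan.\<close>
  define z where "z = Z + 2 * pi / k"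
  have z: "k / 2 * z = k / 2 * Z + pi" using k(1) by (simp add: z_def distrib_left)
  have "z \<ge> Z" using k by (simp add: z_def)
  from dec[OF this] have "arctan (b z / f z) + pi \<le> arctan (b Z / f Z)"
    unfolding g_def z by linarith
  moreover have "arctan (b z / f z) > - (pi / 2)" "arctan (b Z / f Z) < pi / 2"
    using arctan_lbound[of "b z / f z"] arctan_ubound[of "b Z / f Z"] by simp_all
  ultimately show False by linarith
qed


text \<open>With l = g'(p) and y = \<phi> - p, to first order f' = l(A y) = b and b' = l(A (A y)) =
  t b - d f, by the Cayley-Hamilton relation for \<open>A\<close>. The errors are o(|y|), and
  \<open>bd\<close> bounds |y| by |f| + |b|, as the Riccati argument demands.\<close>

lemma focus_functional_not_monotone:
  fixes \<phi> :: "real \<Rightarrow> 'a::real_normed_vector" and g :: "'a \<Rightarrow> real" and g' :: "'a \<Rightarrow> 'a \<Rightarrow>\<^sub>L real"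
  assumes lim: "(\<phi> \<longlongrightarrow> p) at_top" and ne: "\<And>z. \<phi> z \<noteq> p"
    and N: "open N" "p \<in> N"
    and ode: "\<And>z. \<phi> z \<in> N \<Longrightarrow> (\<phi> has_vector_derivative F (\<phi> z)) (at z)"
    and F: "F p = 0" "(F has_derivative A) (at p)"
    and A: "\<And>h. A (A h) = t *\<^sub>R A h - d *\<^sub>R h" and disc: "t\<^sup>2 < 4 * d"
    and g: "\<And>x. x \<in> N \<Longrightarrow> (g has_derivative g' x) (at x)" "isCont g' p"
    and bd: "\<And>h. norm h \<le> K * (\<bar>g' p h\<bar> + \<bar>g' p (A h)\<bar>)"
  shows "\<not> mono (\<lambda>z. g (\<phi> z))"
proof
  assume mono: "mono (\<lambda>z. g (\<phi> z))"
  define l where "l = g' p"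
  define y where "y z = \<phi> z - p" for z
  txt \<open>Monotonicity determines the sign of \<open>f\<close> but not of its linearisation \<open>l (y z)\<close>, so the Riccati
    argument is applied to \<open>f\<close> and \<open>b\<close>.\<close>
  define f where "f z = g (\<phi> z) - g p" for z
  define b where "b z = l (A (y z))" for z
  have blA: "bounded_linear A" using F(2) by (rule has_derivative_bounded_linear)
  obtain KA where KA: "KA > 0" "\<And>h. norm (A h) \<le> norm h * KA"
    using bounded_linear.pos_bounded[OF blA] by blast
  have d: "d > 0" using disc zero_le_power2[of t] by linarith
  \<comment> \<open>Dominates both \<open>KA + 1 + norm l\<close> and
    \<open>norm l * KA + d\<close>, the factors in the two error estimates.\<close>
  define M where "M = 1 + norm l * KA + 1 + KA + norm l + d"
  have M: "M > 0" "M \<ge> 1" using KA d by (auto simp: M_def intro!: add_pos_nonneg)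
  \<comment> \<open>The third condition absorbs the remainder of \<open>g\<close> and gives
    \<open>\<epsilon> \<le> 1 / 2\<close>; the fourth is the smallness condition of
    \<open>focus_riccati_contradiction\<close> for
    \<open>\<epsilon> = 2 * \<bar>K\<bar> * M * \<delta>\<close>.\<close>
  obtain \<delta> where \<delta>: "\<delta> > 0" "\<delta> \<le> 1" "4 * \<bar>K\<bar> * M * \<delta> \<le> 1"
    "16 * (1 + d) * (2 * \<bar>K\<bar> * M * \<delta>) \<le> 4 * d - t\<^sup>2"
  proof -
    have small: "\<exists>\<delta>>0. c * \<delta> \<le> e" if "c \<ge> 0" "e > 0" for c e :: real
      using that by (intro exI[of _ "e / (1 + c)"]) (auto simp: field_simps)
    obtain \<delta>1 where 1: "\<delta>1 > 0" "4 * \<bar>K\<bar> * M * \<delta>1 \<le> 1"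
      using small[of "4 * \<bar>K\<bar> * M" 1] M by auto
    obtain \<delta>2 where 2: "\<delta>2 > 0" "32 * (1 + d) * \<bar>K\<bar> * M * \<delta>2 \<le> 4 * d - t\<^sup>2"
      using small[of "32 * (1 + d) * \<bar>K\<bar> * M" "4 * d - t\<^sup>2"] M d disc by auto
    define \<delta> where "\<delta> = min 1 (min \<delta>1 \<delta>2)"
    have \<delta>: "\<delta> > 0" "\<delta> \<le> 1" "\<delta> \<le> \<delta>1" "\<delta> \<le> \<delta>2" using 1 2 by (auto simp: \<delta>_def)
    have "4 * \<bar>K\<bar> * M * \<delta> \<le> 1"
      using 1 \<delta>(3) M mult_left_mono[of \<delta> \<delta>1 "4 * \<bar>K\<bar> * M"] by force
    moreover have "32 * (1 + d) * \<bar>K\<bar> * M * \<delta> \<le> 4 * d - t\<^sup>2"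
    proof -
      have "0 \<le> 32 * (1 + d) * \<bar>K\<bar> * M" using M d by simp
      from mult_left_mono[OF \<delta>(4) this] 2(2) show ?thesis by linarith
    qed
    ultimately show thesis using \<delta>(1,2) that by (simp add: mult_ac)
  qed
  have "\<forall>\<^sub>F x in nhds p. x \<in> N" using N eventually_nhds by blast
  moreover have "\<forall>\<^sub>F x in nhds p. norm (F x - A (x - p)) \<le> \<delta> * norm (x - p)"
    using F \<delta>(1) unfolding has_derivative_at_alt eventually_nhds_metric dist_norm by auto
  moreover have "\<forall>\<^sub>F x in nhds p. \<bar>g x - g p - l (x - p)\<bar> \<le> \<delta> * norm (x - p)"
    using g(1)[OF N(2)] \<delta>(1) unfolding has_derivative_at_alt eventually_nhds_metric dist_norm l_def
    by auto
  moreover have "\<forall>\<^sub>F x in nhds p. norm (g' x - l) \<le> \<delta>"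
    using g(2) \<delta>(1) unfolding continuous_at_eps_delta l_def eventually_nhds_metric dist_norm
    by (meson less_imp_le)
  ultimately have "\<forall>\<^sub>F x in nhds p. x \<in> N \<and> norm (F x - A (x - p)) \<le> \<delta> * norm (x - p)
      \<and> \<bar>g x - g p - l (x - p)\<bar> \<le> \<delta> * norm (x - p) \<and> norm (g' x - l) \<le> \<delta>"
    by eventually_elim blast
  from eventually_compose_filterlim[OF this lim] obtain Z where Z:
    "\<And>z. z \<ge> Z \<Longrightarrow> \<phi> z \<in> N \<and> norm (F (\<phi> z) - A (y z)) \<le> \<delta> * norm (y z)
      \<and> \<bar>f z - l (y z)\<bar> \<le> \<delta> * norm (y z) \<and> norm (g' (\<phi> z) - l) \<le> \<delta>"
    unfolding eventually_at_top_linorder y_def f_def by blast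
  define f' where "f' z = g' (\<phi> z) (F (\<phi> z))" for z
  define b' where "b' z = l (A (F (\<phi> z)))" for z
  define \<epsilon> where "\<epsilon> = 2 * \<bar>K\<bar> * M * \<delta>"
  have df: "(f has_real_derivative f' z) (at z)" and db: "(b has_real_derivative b' z) (at z)"
    and Y: "norm (y z) \<le> 2 * \<bar>K\<bar> * (\<bar>f z\<bar> + \<bar>b z\<bar>)"
    and f': "\<bar>f' z - b z\<bar> \<le> \<epsilon> * (\<bar>f z\<bar> + \<bar>b z\<bar>)"
    and b': "\<bar>b' z - (t * b z - d * f z)\<bar> \<le> \<epsilon> * (\<bar>f z\<bar> + \<bar>b z\<bar>)" if "z \<ge> Z" for z
  proof -
    note Z = Z[OF that]
    let ?x = "\<phi> z"
    have dphi: "(\<phi> has_derivative (\<lambda>h. h *\<^sub>R F ?x)) (at z)"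
      using ode Z by (simp add: has_vector_derivative_def)
    have "((\<lambda>z. g (\<phi> z)) has_derivative (\<lambda>h. g' ?x (h *\<^sub>R F ?x))) (at z)"
      using has_derivative_compose[OF dphi g(1)] Z by blast
    then show "(f has_real_derivative f' z) (at z)"
      unfolding f_def [abs_def] f'_def has_field_derivative_def
      by (auto intro!: derivative_eq_intros simp: blinfun.scaleR_right mult.commute)
    have "bounded_linear (\<lambda>h. l (A h))"
      using bounded_linear_compose[OF blinfun.bounded_linear_right blA] .
    from bounded_linear.has_derivative[OF this, of y "\<lambda>h. h *\<^sub>R F ?x" "at z"]
    have "(b has_derivative (\<lambda>h. l (A (h *\<^sub>R F ?x)))) (at z)"
      using has_derivative_diff[OF dphi has_derivative_const[of p]]
      by (simp add: b_def [abs_def] y_def [abs_def])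
    then show "(b has_real_derivative b' z) (at z)"
      unfolding b'_def has_field_derivative_def
      by (simp add: linear_scale[OF bounded_linear.linear[OF blA]] blinfun.scaleR_right mult_commute_abs)
    have "norm (y z) \<le> \<bar>K\<bar> * (\<bar>l (y z)\<bar> + \<bar>b z\<bar>)"
      using bd[of "y z"] mult_right_mono[OF abs_ge_self[of K], of "\<bar>l (y z)\<bar> + \<bar>b z\<bar>"]
      unfolding l_def b_def by simp
    also have "\<dots> \<le> \<bar>K\<bar> * (\<bar>f z\<bar> + \<delta> * norm (y z) + \<bar>b z\<bar>)"
      using Z by (intro mult_left_mono) linarith+
    finally have "norm (y z) \<le> \<bar>K\<bar> * (\<bar>f z\<bar> + \<bar>b z\<bar>) + (\<bar>K\<bar> * \<delta>) * norm (y z)"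
      by (simp add: algebra_simps)
    \<comment> \<open>Lets the term with \<open>norm (y z)\<close> on the right be absorbed on the
      left, at the cost of a factor 2.\<close>
    moreover have "\<bar>K\<bar> * \<delta> \<le> 1 / 2"
    proof -
      have "\<bar>K\<bar> * \<delta> * 1 \<le> \<bar>K\<bar> * \<delta> * M" using M \<delta> by (intro mult_left_mono) auto
      then show ?thesis using \<delta>(3) by (simp add: mult_ac)
    qed
    then have "(\<bar>K\<bar> * \<delta>) * norm (y z) \<le> 1 / 2 * norm (y z)" by (intro mult_right_mono) auto
    ultimately show Y: "norm (y z) \<le> 2 * \<bar>K\<bar> * (\<bar>f z\<bar> + \<bar>b z\<bar>)" by linarith
    have *: "M * (\<delta> * norm (y z)) \<le> \<epsilon> * (\<bar>f z\<bar> + \<bar>b z\<bar>)"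
      using mult_left_mono[OF Y, of "M * \<delta>"] M \<delta> by (simp add: \<epsilon>_def mult_ac)
    have rem: "\<bar>l h\<bar> \<le> norm l * norm h" for h using norm_blinfun[of l h] by simp
    have F1: "norm (F ?x) \<le> (KA + 1) * norm (y z)"
    proof -
      have "norm (F ?x) \<le> norm (F ?x - A (y z)) + norm (A (y z))" 
        using norm_triangle_sub[of "F ?x" "A (y z)"] by simp
      also have "\<dots> \<le> \<delta> * norm (y z) + norm (y z) * KA" using Z KA(2) by (intro add_mono) auto
      also have "\<dots> \<le> 1 * norm (y z) + norm (y z) * KA"
        using mult_right_mono[OF \<delta>(2), of "norm (y z)"] by simp
      finally show ?thesis by (simp add: algebra_simps)
    qed
    have "f' z - b z = (g' ?x - l) (F ?x) + l (F ?x - A (y z))"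
      by (simp add: f'_def b_def blinfun.bilinear_simps)
    also have "\<bar>\<dots>\<bar> \<le> norm (g' ?x - l) * norm (F ?x) + norm l * norm (F ?x - A (y z))"
      using norm_blinfun[of "g' ?x - l" "F ?x"] rem[of "F ?x - A (y z)"] by auto
    also have "\<dots> \<le> \<delta> * ((KA + 1) * norm (y z)) + norm l * (\<delta> * norm (y z))"
      using Z F1 \<delta> KA(1) by (intro add_mono mult_mono mult_left_mono) auto
    also have "\<dots> = (KA + 1 + norm l) * (\<delta> * norm (y z))" by (simp add: algebra_simps)
    also have "\<dots> \<le> M * (\<delta> * norm (y z))"
      using \<delta> d KA by (intro mult_right_mono) (auto simp: M_def)
    finally show "\<bar>f' z - b z\<bar> \<le> \<epsilon> * (\<bar>f z\<bar> + \<bar>b z\<bar>)" using * by linarith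
    have "t * b z - d * l (y z) = l (A (A (y z)))"
      by (simp add: A b_def blinfun.bilinear_simps)
    then have "b' z - (t * b z - d * f z) = l (A (F ?x - A (y z))) + d * (f z - l (y z))"
      by (simp add: b'_def blinfun.bilinear_simps linear_diff[OF bounded_linear.linear[OF blA]] algebra_simps)
    also have "\<bar>\<dots>\<bar> \<le> norm l * norm (A (F ?x - A (y z))) + d * \<bar>f z - l (y z)\<bar>"
      using abs_triangle_ineq[of "l (A (F ?x - A (y z)))" "d * (f z - l (y z))"]
        rem[of "A (F ?x - A (y z))"] d by (simp add: abs_mult)
    also have "\<dots> \<le> norm l * (norm (F ?x - A (y z)) * KA) + d * \<bar>f z - l (y z)\<bar>"
      using KA(2) by (intro add_right_mono mult_left_mono) auto
    also have "\<dots> \<le> norm l * ((\<delta> * norm (y z)) * KA) + d * (\<delta> * norm (y z))"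
      using Z d KA(1) by (intro add_mono mult_left_mono mult_right_mono) auto
    also have "\<dots> = (norm l * KA + d) * (\<delta> * norm (y z))" by (simp add: algebra_simps)
    also have "\<dots> \<le> M * (\<delta> * norm (y z))"
      using \<delta> d KA by (intro mult_right_mono) (auto simp: M_def)
    finally show "\<bar>b' z - (t * b z - d * f z)\<bar> \<le> \<epsilon> * (\<bar>f z\<bar> + \<bar>b z\<bar>)" using * by linarith
  qed
  have glim: "((\<lambda>z. g (\<phi> z)) \<longlongrightarrow> g p) at_top"
    using g(1)[OF N(2)] lim has_derivative_continuous isCont_tendsto_compose by blast
  have nonpos: "f z \<le> 0" for z
  proof -
    have "g (\<phi> z) \<le> g p"
      by (rule tendsto_lowerbound[OF glim])
        (auto simp: eventually_at_top_linorder intro!: exI[of _ z] monoD[OF mono])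
    then show ?thesis by (simp add: f_def)
  qed
  \<comment> \<open>By monotonicity a zero of \<open>f\<close> would persist; then f' = 0 forces b =
    0 and hence y = 0, contradicting \<open>ne\<close>.\<close>
  have nz: "f z \<noteq> 0" if "z \<ge> Z" for z
  proof
    assume "f z = 0"
    then have f0: "f x = 0" if "x \<ge> z" for x
      using nonpos[of x] monoD[OF mono that] by (simp add: f_def)
    \<comment> \<open>Strictly to the right of \<open>z\<close>, so that \<open>f\<close> vanishes
      on a two-sided neighbourhood.\<close>
    define x where "x = z + 1"
    have x: "x \<ge> Z" "f x = 0" using f0 \<open>z \<ge> Z\<close> by (auto simp: x_def)
    have "(f has_real_derivative 0) (at x)"
      using f0 by (intro DERIV_cong_ev[THEN iffD1, OF refl _ refl, OF _ DERIV_const[of 0]])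
        (auto simp: eventually_nhds x_def intro!: exI[of _ "{z<..}"])
    then have "f' x = 0" using df[OF x(1)] DERIV_unique by blast
    then have "\<bar>b x\<bar> \<le> \<epsilon> * \<bar>b x\<bar>" using f'[OF x(1)] x(2) by simp
    also have "\<dots> \<le> 1 / 2 * \<bar>b x\<bar>" using \<delta>(3) by (intro mult_right_mono) (auto simp: \<epsilon>_def)
    finally have "b x = 0" by simp
    then show False using Y[OF x(1)] x(2) ne[of x] by (simp add: y_def)
  qed
  show False
    by (rule focus_riccati_contradiction[OF disc nz df db f' b']) (use \<delta>(4) in \<open>auto simp: \<epsilon>_def\<close>)
qed

text \<open>The product rule term with the derivative of \<open>c\<close> carries the factor g(x) =
  0, so continuity of \<open>c\<close> suffices. This linearises the vector field at the rest point
  without differentiating an inverse matrix.\<close>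

lemma has_derivative_mult_at_zero:
  fixes c g :: "'a::real_normed_vector \<Rightarrow> real"
  assumes c: "isCont c x" and g: "(g has_derivative g') (at x)" "g x = 0"
  shows "((\<lambda>y. c y * g y) has_derivative (\<lambda>h. c x * g' h)) (at x)"
proof -
  have bl: "bounded_linear g'" using g(1) by (rule has_derivative_bounded_linear)
  obtain K where K: "K > 0" "\<And>h. norm (g' h) \<le> norm h * K"
    using bounded_linear.pos_bounded[OF bl] by blast
  have "\<exists>d>0. \<forall>y. norm (y - x) < d \<longrightarrow>
      norm (c y * g y - c x * g x - c x * g' (y - x)) \<le> e * norm (y - x)" if "e > 0" for e
  proof -
    \<comment> \<open>The cap 1 bounds |c y| by |c x| + 1; each of the two error terms then receives
      half of \<open>e\<close>.\<close>
    let ?e1 = "min 1 (e / (2 * K))" and ?e2 = "e / (2 * (\<bar>c x\<bar> + 1))"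
    have e: "?e1 > 0" "?e2 > 0" using that K by auto
    obtain d1 where d1: "d1 > 0" "\<And>y. norm (y - x) < d1 \<Longrightarrow> \<bar>c y - c x\<bar> < ?e1"
      using c e(1) unfolding continuous_at_eps_delta dist_norm real_norm_def by blast
    obtain d2 where d2: "d2 > 0" "\<And>y. norm (y - x) < d2 \<Longrightarrow> \<bar>g y - g' (y - x)\<bar> \<le> ?e2 * norm (y - x)"
      using g e(2) unfolding has_derivative_at_alt by (auto simp: real_norm_def)
    have "norm (c y * g y - c x * g x - c x * g' (y - x)) \<le> e * norm (y - x)"
      if y: "norm (y - x) < min d1 d2" for y
    proof -
      have c1: "\<bar>c y - c x\<bar> \<le> e / (2 * K)" "\<bar>c y\<bar> \<le> \<bar>c x\<bar> + 1" using d1(2)[of y] y by auto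
      have "c y * g y - c x * g x - c x * g' (y - x)
          = c y * (g y - g' (y - x)) + (c y - c x) * g' (y - x)"
        using g(2) by (simp add: algebra_simps)
      also have "\<bar>\<dots>\<bar> \<le> \<bar>c y\<bar> * \<bar>g y - g' (y - x)\<bar> + \<bar>c y - c x\<bar> * \<bar>g' (y - x)\<bar>"
        by (metis abs_mult abs_triangle_ineq)
      also have "\<dots> \<le> (\<bar>c x\<bar> + 1) * (?e2 * norm (y - x)) + e / (2 * K) * (norm (y - x) * K)"
        using c1 d2(2)[of y] y K(2)[of "y - x"] that by (intro add_mono mult_mono) auto
      also have "\<dots> = e * norm (y - x)"
        using K(1) by (simp add: field_simps)
      finally show ?thesis by simp
    qed
    then show ?thesis using d1(1) d2(1) by (intro exI[of _ "min d1 d2"]) auto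
  qed
  then show ?thesis
    unfolding has_derivative_at_alt using bounded_linear_const_mult[OF bl, of "c x"] by blast
qed

text \<open>In the plane, l h = l (A h) = 0 puts \<open>h\<close> and \<open>A h\<close> on one
  line, so a nonzero \<open>h\<close> would be an eigenvector, while t^2 < 4 d excludes real
  eigenvalues. Hence h \<mapsto> (l h, l (A h)) is injective, and bounded below by finite
  dimension.\<close>

lemma norm_le_functional_orbit:
  fixes l :: "state \<Rightarrow>\<^sub>L real"
  assumes l: "l \<noteq> 0" and blA: "bounded_linear A"
    and A: "\<And>h. A (A h) = t *\<^sub>R A h - d *\<^sub>R h" and disc: "t\<^sup>2 < 4 * d"
  obtains K where "\<And>h. norm h \<le> K * (\<bar>l h\<bar> + \<bar>l (A h)\<bar>)"
proof -
  interpret A: bounded_linear A by fact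
  define L where "L h = (l h, l (A h))" for h
  have blL: "bounded_linear L"
    unfolding L_def using bounded_linear_compose[OF blinfun.bounded_linear_right blA]
    by (intro bounded_linear_Pair blinfun.bounded_linear_right)
  have coord: "l h = fst h * l (1, 0) + snd h * l (0, 1)" for h
  proof -
    have "h = fst h *\<^sub>R (1, 0) + snd h *\<^sub>R (0, 1)" by (cases h) simp
    then show ?thesis by (metis blinfun.add_right blinfun.scaleR_right real_scaleR_def)
  qed
  have "h = 0" if "L h = 0" for h
  proof (rule ccontr)
    assume "h \<noteq> 0"
    have "l h = 0" "l (A h) = 0" using that by (simp_all add: L_def zero_prod_def)
    have "fst h * snd (A h) = snd h * fst (A h)"
    proof -
      have 1: "fst h * l (1, 0) + snd h * l (0, 1) = 0"
        "fst (A h) * l (1, 0) + snd (A h) * l (0, 1) = 0"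
        using \<open>l h = 0\<close> \<open>l (A h) = 0\<close> coord by metis+
      then have "(fst h * snd (A h) - snd h * fst (A h)) * l (1, 0) = 0"
        "(fst h * snd (A h) - snd h * fst (A h)) * l (0, 1) = 0" by algebra+
      moreover have "l (1, 0) \<noteq> 0 \<or> l (0, 1) \<noteq> 0"
        using l coord by (metis add_0 blinfun_eqI mult_zero_right zero_blinfun.rep_eq)
      ultimately show ?thesis by auto
    qed
    then obtain c where c: "A h = c *\<^sub>R h"
      using \<open>h \<noteq> 0\<close> by (cases h; cases "A h"; cases "fst h = 0")
       (auto simp: zero_prod_def field_simps intro: that[of "fst (A h) / fst h"] that[of "snd (A h) / snd h"])
    have "c *\<^sub>R c *\<^sub>R h = t *\<^sub>R c *\<^sub>R h - d *\<^sub>R h"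
      using A[of h] by (simp add: c A.scaleR)
    then have "(c * c - t * c + d) *\<^sub>R h = 0" by (simp add: algebra_simps)
    then have "c * c - t * c + d = 0" using \<open>h \<noteq> 0\<close> by simp
    then have "(2 * c - t)\<^sup>2 = t\<^sup>2 - 4 * d" by (simp add: power2_eq_square algebra_simps)
    then show False using disc zero_le_power2[of "2 * c - t"] by linarith
  qed
  then have "inj L" using linear_injective_0[OF bounded_linear.linear[OF blL]] by blast
  then obtain B where B: "B > 0" "\<And>h. B * norm h \<le> norm (L h)"
    using linear_inj_bounded_below_pos[OF bounded_linear.linear[OF blL]] by blast
  show thesis
  proof (rule that)
    fix h
    have "B * norm h \<le> \<bar>l h\<bar> + \<bar>l (A h)\<bar>"
      using B(2)[of h] norm_Pair_le[of "l h" "l (A h)"] by (simp add: L_def)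
    then show "norm h \<le> (1 / B) * (\<bar>l h\<bar> + \<bar>l (A h)\<bar>)" using B(1) by (simp add: field_simps)
  qed
qed

section \<open>Oscillation in arbitrary state variables\<close>

lemma focus_functional_oscillates:
  fixes \<phi> :: "real \<Rightarrow> state" and g' :: "state \<Rightarrow> state \<Rightarrow>\<^sub>L real"
  assumes cont: "continuous_on UNIV \<phi>"
    and lim: "(\<phi> \<longlongrightarrow> m) at_bot" "(\<phi> \<longlongrightarrow> p) at_top" "m \<noteq> p"
    and N: "open N" "p \<in> N"
    and ode: "\<And>z. \<phi> z \<in> N \<Longrightarrow> (\<phi> has_vector_derivative F (\<phi> z)) (at z)"
    and F: "F p = 0" "(F has_derivative A) (at p)"
    and A: "\<And>h. A (A h) = t *\<^sub>R A h - d *\<^sub>R h" and disc: "t\<^sup>2 < 4 * d"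
    and g: "\<And>x. x \<in> N \<Longrightarrow> (g has_derivative g' x) (at x)" "isCont g' p" "g' p \<noteq> 0"
  shows "\<not> monotone_function (\<lambda>z. g (\<phi> z))"
proof -
  have blA: "bounded_linear A" using F(2) by (rule has_derivative_bounded_linear)
  obtain KA where KA: "\<And>h. norm (A h) \<le> norm h * KA"
    using bounded_linear.pos_bounded[OF blA] by blast
  obtain r where r: "r > 0" "\<And>x. dist x p < r \<Longrightarrow> norm (F x - A (x - p)) \<le> 1 * norm (x - p)"
    using F unfolding has_derivative_at_alt dist_norm by (metis diff_zero zero_less_one)
  have lip: "norm (F x) \<le> (KA + 1) * norm (x - p)" if "x \<in> N \<inter> ball p r" for x
    using r(2)[of x] KA[of "x - p"] that norm_triangle_sub[of "F x" "A (x - p)"]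
    by (simp add: dist_commute algebra_simps)
  \<comment> \<open>A trajectory that reached \<open>p\<close> would be constant and could not tend
    to \<open>m\<close> at minus infinity.\<close>
  have ne: "\<phi> z \<noteq> p" for z
  proof
    assume z: "\<phi> z = p"
    have "\<phi> x = p" for x
      by (rule rest_point_unique[where N = "N \<inter> ball p r" and F = F and C = "KA + 1", OF cont _ _ lip _ z])
        (use N r ode in auto)
    then have "(\<phi> \<longlongrightarrow> p) at_bot" by (simp add: tendsto_eventually)
    then show False using lim(1,3) tendsto_unique[OF trivial_limit_at_bot_linorder] by blast
  qed
  have *: "\<not> mono (\<lambda>z. h (\<phi> z))" if h: "\<And>x. x \<in> N \<Longrightarrow> (h has_derivative h' x) (at x)" "isCont h' p" "h' p \<noteq> 0"
    for h and h' :: "state \<Rightarrow> state \<Rightarrow>\<^sub>L real"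
  proof -
    obtain K where "\<And>v. norm v \<le> K * (\<bar>h' p v\<bar> + \<bar>h' p (A v)\<bar>)"
      using norm_le_functional_orbit[OF h(3) blA A disc] by blast
    from focus_functional_not_monotone[OF lim(2) ne N ode F A disc h(1,2) this] show ?thesis .
  qed
  \<comment> \<open>Decreasing \<open>g\<close> is increasing \<open>- g\<close>, so the same fact
    excludes both directions.\<close>
  have "\<not> mono (\<lambda>z. - g (\<phi> z))"
    by (rule *[of "\<lambda>x. - g x" "\<lambda>x. - g' x"])
      (use g in \<open>auto intro!: has_derivative_minus continuous_minus simp: uminus_blinfun.rep_eq fun_Compl_def\<close>)
  then have "\<not> antimono (\<lambda>z. g (\<phi> z))" by (simp add: monotone_def)
  with *[OF g] show ?thesis by (simp add: monotone_function_def)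
qed

text \<open>Each component of \<open>V\<close> is a C^1 function whose differential at
  \<open>p\<close> is nonzero because the derivative of \<open>V\<close> is onto; this reduces the
  claim to a single functional.\<close>

lemma focus_oscillatory:
  fixes \<phi> :: "real \<Rightarrow> state"
  assumes cont: "continuous_on UNIV \<phi>"
    and lim: "(\<phi> \<longlongrightarrow> m) at_bot" "(\<phi> \<longlongrightarrow> p) at_top" "m \<noteq> p"
    and N: "open N" "p \<in> N" "N \<subseteq> state_space"
    and ode: "\<And>z. \<phi> z \<in> N \<Longrightarrow> (\<phi> has_vector_derivative F (\<phi> z)) (at z)"
    and F: "F p = 0" "(F has_derivative A) (at p)"
    and A: "\<And>h. A (A h) = t *\<^sub>R A h - d *\<^sub>R h" and disc: "t\<^sup>2 < 4 * d"
  shows "oscillatory \<phi>"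
  unfolding oscillatory_def
proof (intro allI impI)
  fix V assume "state_variables V"
  then obtain V' :: "state \<Rightarrow> (state \<Rightarrow>\<^sub>L (real \<times> real))" where V':
    "continuous_on state_space V'"
    "\<And>\<psi>. \<psi> \<in> state_space \<Longrightarrow> (V has_derivative blinfun_apply (V' \<psi>)) (at \<psi>)"
    "\<And>\<psi>. \<psi> \<in> state_space \<Longrightarrow> bij (blinfun_apply (V' \<psi>))"
    unfolding state_variables_def by blast
  have "isCont V' p"
    using continuous_on_interior[OF V'(1)] N by (meson interiorI)
  then have cont': "isCont (\<lambda>x. P o\<^sub>L V' x) p" for P :: "(real \<times> real) \<Rightarrow>\<^sub>L real"
    by (intro continuous_intros)
  have *: "\<not> monotone_function (\<lambda>z. P (V (\<phi> z)))" if "P \<noteq> 0" for P :: "(real \<times> real) \<Rightarrow>\<^sub>L real"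
  proof (rule focus_functional_oscillates[OF cont lim N(1,2) ode F A disc, where g = "\<lambda>x. P (V x)" and g' = "\<lambda>x. P o\<^sub>L V' x"])
    show "((\<lambda>x. P (V x)) has_derivative blinfun_apply (P o\<^sub>L V' x)) (at x)" if "x \<in> N" for x
      using bounded_linear.has_derivative[OF blinfun.bounded_linear_right V'(2), of x P] that N(3)
      by (auto simp: blinfun_compose.rep_eq o_def)
    show "P o\<^sub>L V' p \<noteq> 0"
    proof
      assume 0: "P o\<^sub>L V' p = 0"
      have "P v = 0" for v
      proof -
        obtain u where "v = V' p u" using V'(3)[of p] N by (metis bij_pointE subsetD)
        then show ?thesis using 0 by (metis blinfun_apply_blinfun_compose zero_blinfun.rep_eq)
      qed
      then show False using that by (simp add: blinfun_eqI)
    qed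
  qed (use cont' in auto)
  have "fst_blinfun \<noteq> (0 :: (real \<times> real) \<Rightarrow>\<^sub>L real)" "snd_blinfun \<noteq> (0 :: (real \<times> real) \<Rightarrow>\<^sub>L real)"
    by (metis blinfun_apply_fst_blinfun fst_conv zero_blinfun.rep_eq zero_neq_one)
       (metis blinfun_apply_snd_blinfun snd_conv zero_blinfun.rep_eq zero_neq_one)
  from *[OF this(1)] *[OF this(2)]
  show "\<not> monotone_function (\<lambda>z. fst (V (\<phi> z))) \<and> \<not> monotone_function (\<lambda>z. snd (V (\<phi> z)))" by simp
qed

subsection \<open>The tensors in coordinates\<close>

text \<open>This is $-\psi_\gamma\psi^\gamma = \theta^{-2}$.\<close>

abbreviation msq :: "state \<Rightarrow> real" where "msq \<psi> \<equiv> (fst \<psi>)\<^sup>2 - (snd \<psi>)\<^sup>2"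

lemma msq_pos: "\<psi> \<in> state_space \<Longrightarrow> msq \<psi> > 0"
  using power_strict_mono[of "\<bar>snd \<psi>\<bar>" "fst \<psi>" 2] by (simp add: state_space_def)

lemma sum_lessThan_4: "(\<Sum>i<4. f i) = f 0 + f (Suc 0) + f 2 + f (3::nat)" for f :: "nat \<Rightarrow> real"
  by (simp add: numeral_eq_Suc)

lemma sum_lessThan_2: "(\<Sum>i<2. f i) = f 0 + f (Suc 0)" for f :: "nat \<Rightarrow> real"
  by (simp add: numeral_eq_Suc)

lemma all_less_2: "(\<forall>i<2. P i) \<longleftrightarrow> P 0 \<and> P (Suc 0)" for P :: "nat \<Rightarrow> bool"
  by (auto simp: numeral_eq_Suc less_Suc_eq)

lemma temperature_eq:
  assumes "\<psi> \<in> state_space"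
  shows "temperature \<psi> = 1 / sqrt (msq \<psi>)"
proof -
  have "- (\<Sum>\<gamma><4. lower (four \<psi>) \<gamma> * four \<psi> \<gamma>) = msq \<psi>"
    by (simp add: sum_lessThan_4 lower_def minkowski_def four_def power2_eq_square)
  then show ?thesis
    using msq_pos[OF assms] unfolding temperature_def
    by (simp add: powr_minus powr_half_sqrt inverse_eq_divide)
qed

lemma temperature_square:
  assumes "\<psi> \<in> state_space"
  shows "temperature \<psi> * temperature \<psi> = 1 / msq \<psi>"
  using msq_pos[OF assms] by (simp add: temperature_eq[OF assms])

lemma temperature_pos: "\<psi> \<in> state_space \<Longrightarrow> temperature \<psi> > 0"
  using msq_pos[of \<psi>] by (simp add: temperature_eq)

lemma deriv_pressure: "deriv pressure \<theta> = 4 / 3 * \<theta> ^ 3"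
  unfolding pressure_def [abs_def]
  by (rule DERIV_imp_deriv) (auto intro!: derivative_eq_intros)

lemma ideal_tensor_eq:
  assumes "\<psi> \<in> state_space"
  shows "ideal_tensor \<psi> \<alpha> \<beta> =
    4 / 3 * four \<psi> \<alpha> * four \<psi> \<beta> / msq \<psi> ^ 3 + minkowski \<alpha> \<beta> / (3 * msq \<psi> ^ 2)"
proof -
  let ?t = "temperature \<psi>"
  \<comment> \<open>Only even powers of the temperature occur, so the square root disappears and the
    tensor is rational in the state.\<close>
  have "?t ^ 3 * ?t ^ 3 = (?t * ?t) ^ 3" "?t ^ 4 = (?t * ?t) ^ 2"
    by (simp_all add: power_mult_distrib flip: power_mult power_add power2_eq_square)
  then show ?thesis
    unfolding ideal_tensor_def deriv_pressure pressure_def temperature_square[OF assms]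
    by (simp add: power_divide algebra_simps)
qed

lemma fluid_speed_eq: "\<psi> \<in> state_space \<Longrightarrow> fluid_speed \<psi> = snd \<psi> / fst \<psi>"
  using temperature_pos[of \<psi>] by (simp add: fluid_speed_def velocity_def four_def)

lemma proj_eq:
  assumes "\<psi> \<in> state_space"
  defines "a \<equiv> fst \<psi>" and "b \<equiv> snd \<psi>"
  shows "proj \<psi> 0 0 = b\<^sup>2 / msq \<psi>" "proj \<psi> 0 (Suc 0) = a * b / msq \<psi>"
    "proj \<psi> (Suc 0) 0 = a * b / msq \<psi>" "proj \<psi> (Suc 0) (Suc 0) = a\<^sup>2 / msq \<psi>"
    "proj \<psi> 0 2 = 0" "proj \<psi> 0 3 = 0" "proj \<psi> (Suc 0) 2 = 0" "proj \<psi> (Suc 0) 3 = 0"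
proof -
  have *: "velocity \<psi> i * velocity \<psi> j = four \<psi> i * four \<psi> j / msq \<psi>" for i j
    using temperature_square[OF assms(1)] unfolding velocity_def
    by (metis (no_types, opaque_lifting) mult.assoc mult.left_commute mult_1 times_divide_eq_left times_divide_eq_right)
  show "proj \<psi> 0 0 = b\<^sup>2 / msq \<psi>" "proj \<psi> 0 (Suc 0) = a * b / msq \<psi>"
    "proj \<psi> (Suc 0) 0 = a * b / msq \<psi>" "proj \<psi> (Suc 0) (Suc 0) = a\<^sup>2 / msq \<psi>"
    "proj \<psi> 0 2 = 0" "proj \<psi> 0 3 = 0" "proj \<psi> (Suc 0) 2 = 0" "proj \<psi> (Suc 0) 3 = 0"
    using msq_pos[OF assms(1)] unfolding proj_def * 
    by (auto simp: four_def minkowski_def a_def b_def field_simps power2_eq_square)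
qed

text \<open>Upper triangle of the symmetric matrix $B^{\alpha 1\gamma 1}$, $\alpha,\gamma\in\{0,1\}$, multiplied by
  the square of \<open>msq\<close> so that its entries are polynomials.\<close>

definition diss_matrix :: "real \<Rightarrow> real \<Rightarrow> real \<Rightarrow> state \<Rightarrow> real \<times> real \<times> real" where
  "diss_matrix \<eta> \<mu> \<nu> \<psi> = (let a = fst \<psi>; b = snd \<psi> in
    (4/3 * \<eta> * a\<^sup>2 * b\<^sup>2 - 16 * \<mu> * a\<^sup>2 * b\<^sup>2 - \<nu> * (a\<^sup>2 + b\<^sup>2)\<^sup>2,
     4/3 * \<eta> * a^3 * b - 4 * \<mu> * a * b * (a\<^sup>2 + 3 * b\<^sup>2) - 2 * \<nu> * a * b * (a\<^sup>2 + b\<^sup>2),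
     4/3 * \<eta> * a^4 - \<mu> * (a\<^sup>2 + 3 * b\<^sup>2)\<^sup>2 - 4 * \<nu> * a\<^sup>2 * b\<^sup>2))"

lemma B_diss_eq:
  assumes "\<psi> \<in> state_space" "diss_matrix \<eta> \<mu> \<nu> \<psi> = (B00, B01, B11)"
  shows "B_diss \<eta> \<mu> \<nu> \<psi> 0 1 0 1 = B00 / (msq \<psi>)\<^sup>2"
    "B_diss \<eta> \<mu> \<nu> \<psi> 0 1 1 1 = B01 / (msq \<psi>)\<^sup>2"
    "B_diss \<eta> \<mu> \<nu> \<psi> 1 1 0 1 = B01 / (msq \<psi>)\<^sup>2"
    "B_diss \<eta> \<mu> \<nu> \<psi> 1 1 1 1 = B11 / (msq \<psi>)\<^sup>2"
proof -
  obtain a b where ab: "\<psi> = (a, b)" by force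
  define n where "n = msq \<psi>"
  have n: "n > 0" "a\<^sup>2 = n + b\<^sup>2" using msq_pos[OF assms(1)] by (auto simp: n_def ab)
  define t where "t = temperature \<psi>"
  have t: "t * t = 1 / n"
    using temperature_square[OF assms(1)] by (simp add: t_def n_def)
  have v: "velocity \<psi> 0 = t * a" "velocity \<psi> (Suc 0) = t * b"
    by (simp_all add: velocity_def t_def four_def ab)
  note p = proj_eq[OF assms(1), folded n_def, unfolded ab fst_conv snd_conv, folded ab]
  \<comment> \<open>The projection has rank one on the indices 0, 1, so all three products agree and
    1 + 1 - 2/3 = 4/3 remains.\<close>
  have V: "B_visc \<psi> 0 1 0 1 = 4/3 * a\<^sup>2 * b\<^sup>2 / n\<^sup>2"
    "B_visc \<psi> 0 1 1 1 = 4/3 * a^3 * b / n\<^sup>2"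
    "B_visc \<psi> 1 1 0 1 = 4/3 * a^3 * b / n\<^sup>2"
    "B_visc \<psi> 1 1 1 1 = 4/3 * a^4 / n\<^sup>2"
    by (simp_all add: B_visc_def p power2_eq_square power3_eq_cube power4_eq_xxxx)
  have t': "t * (t * c) = c / n" for c using t by (metis mult.assoc mult_1 times_divide_eq_left)
  have o: "3 * velocity \<psi> 0 * velocity \<psi> 1 + proj \<psi> 0 1 = 4 * a * b / n"
     "3 * velocity \<psi> 1 * velocity \<psi> 1 + proj \<psi> 1 1 = (a\<^sup>2 + 3 * b\<^sup>2) / n"
    by (simp_all add: v p mult_ac t' add_divide_distrib power2_eq_square)
  have O: "B_one \<psi> 0 1 0 1 = 16 * a\<^sup>2 * b\<^sup>2 / n\<^sup>2"
    "B_one \<psi> 0 1 1 1 = 4 * a * b * (a\<^sup>2 + 3 * b\<^sup>2) / n\<^sup>2"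
    "B_one \<psi> 1 1 0 1 = 4 * a * b * (a\<^sup>2 + 3 * b\<^sup>2) / n\<^sup>2"
    "B_one \<psi> 1 1 1 1 = (a\<^sup>2 + 3 * b\<^sup>2)\<^sup>2 / n\<^sup>2"
    unfolding B_one_def o by (simp_all add: power2_eq_square)
  \<comment> \<open>The bracket u^\<alpha> \<Pi>^{1\<epsilon>} + u^1 \<Pi>^{\<alpha>\<epsilon>}
    factors as \<open>x \<alpha>\<close> times (b, a), a vector orthogonal to (a, b) with Minkowski
    square \<open>n\<close>. Hence \<open>B_two\<close> becomes a rank one matrix.\<close>
  define x where "x = (\<lambda>i::nat. (if i = 0 then a\<^sup>2 + b\<^sup>2 else 2 * a * b) * t / n)"
  have q: "velocity \<psi> \<alpha> * proj_mixed \<psi> 1 0 + velocity \<psi> 1 * proj_mixed \<psi> \<alpha> 0 = - b * x \<alpha>"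
    "velocity \<psi> \<alpha> * proj_mixed \<psi> 1 (Suc 0) + velocity \<psi> 1 * proj_mixed \<psi> \<alpha> (Suc 0) = a * x \<alpha>"
    "velocity \<psi> \<alpha> * proj \<psi> 1 0 + velocity \<psi> 1 * proj \<psi> \<alpha> 0 = b * x \<alpha>"
    "velocity \<psi> \<alpha> * proj \<psi> 1 (Suc 0) + velocity \<psi> 1 * proj \<psi> \<alpha> (Suc 0) = a * x \<alpha>"
    "velocity \<psi> \<alpha> * proj \<psi> 1 2 + velocity \<psi> 1 * proj \<psi> \<alpha> 2 = 0"
    "velocity \<psi> \<alpha> * proj \<psi> 1 3 + velocity \<psi> 1 * proj \<psi> \<alpha> 3 = 0"
    if "\<alpha> < 2" for \<alpha>
    using that less_2_cases[OF that] n(1)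
    by (auto simp: x_def proj_mixed_def lower_def sum_lessThan_4 minkowski_def v p
          field_simps power2_eq_square)
  have two: "B_two \<psi> \<alpha> 1 \<gamma> 1 = n * x \<alpha> * x \<gamma>" if "\<alpha> < 2" "\<gamma> < 2" for \<alpha> \<gamma>
    unfolding B_two_def sum_lessThan_4 q[OF that(1)] q[OF that(2)] mult_zero_right
    by (simp add: n_def ab algebra_simps power2_eq_square)
  have xx: "n * (c * t / n) * (d * t / n) = c * d / n\<^sup>2" for c d
    using n(1) by (simp add: mult_ac t power2_eq_square)
  have W: "B_two \<psi> 0 1 0 1 = (a\<^sup>2 + b\<^sup>2)\<^sup>2 / n\<^sup>2"
    "B_two \<psi> 0 1 1 1 = 2 * a * b * (a\<^sup>2 + b\<^sup>2) / n\<^sup>2"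
    "B_two \<psi> 1 1 0 1 = 2 * a * b * (a\<^sup>2 + b\<^sup>2) / n\<^sup>2"
    "B_two \<psi> 1 1 1 1 = 4 * a\<^sup>2 * b\<^sup>2 / n\<^sup>2"
    using two[of 0 0] two[of 0 1] two[of 1 0] two[of 1 1] unfolding x_def xx
    by (simp_all add: power2_eq_square)
  have e: "B00 = 4/3 * \<eta> * a\<^sup>2 * b\<^sup>2 - 16 * \<mu> * a\<^sup>2 * b\<^sup>2 - \<nu> * (a\<^sup>2 + b\<^sup>2)\<^sup>2"
     "B01 = 4/3 * \<eta> * a^3 * b - 4 * \<mu> * a * b * (a\<^sup>2 + 3 * b\<^sup>2) - 2 * \<nu> * a * b * (a\<^sup>2 + b\<^sup>2)"
     "B11 = 4/3 * \<eta> * a^4 - \<mu> * (a\<^sup>2 + 3 * b\<^sup>2)\<^sup>2 - 4 * \<nu> * a\<^sup>2 * b\<^sup>2"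
    using assms(2) by (simp_all add: diss_matrix_def Let_def ab)
  show "B_diss \<eta> \<mu> \<nu> \<psi> 0 1 0 1 = B00 / (msq \<psi>)\<^sup>2"
    "B_diss \<eta> \<mu> \<nu> \<psi> 0 1 1 1 = B01 / (msq \<psi>)\<^sup>2"
    "B_diss \<eta> \<mu> \<nu> \<psi> 1 1 0 1 = B01 / (msq \<psi>)\<^sup>2"
    "B_diss \<eta> \<mu> \<nu> \<psi> 1 1 1 1 = B11 / (msq \<psi>)\<^sup>2"
    unfolding B_diss_def V O W n_def[symmetric] e
    by (simp_all add: diff_divide_distrib mult.assoc)
qed

text \<open>Upper triangle of the Jacobian of $\psi \mapsto (T^{01}, T^{11})$ with respect to the covariant
  components $(-\psi^0, \psi^1)$, up to the factor \<open>4 / (3 * msq \<psi> ^ 4)\<close>; in these coordinates it is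
  symmetric.\<close>

definition flux_matrix :: "state \<Rightarrow> real \<times> real \<times> real" where
  "flux_matrix \<psi> = (let a = fst \<psi>; b = snd \<psi> in
    (b * (5 * a\<^sup>2 + b\<^sup>2), a * (a\<^sup>2 + 5 * b\<^sup>2), 3 * b * (a\<^sup>2 + b\<^sup>2)))"

lemma open_state_space: "open state_space"
  unfolding state_space_def by (intro open_Collect_less continuous_intros)

text \<open>T^{01} and T^{11} as rational functions with the temperature eliminated, ready for
  differentiation; every nonzero index stands for 1.\<close>

definition flux :: "nat \<Rightarrow> state \<Rightarrow> real" where
  "flux \<alpha> \<psi> = (if \<alpha> = 0 then 4 / 3 * fst \<psi> * snd \<psi> / msq \<psi> ^ 3
     else 4 / 3 * (snd \<psi>)\<^sup>2 / msq \<psi> ^ 3 + 1 / (3 * (msq \<psi>)\<^sup>2))"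

lemma ideal_tensor_flux:
  assumes "\<psi> \<in> state_space" "\<alpha> < 2"
  shows "ideal_tensor \<psi> \<alpha> 1 = flux \<alpha> \<psi>"
  using less_2_cases[OF assms(2)]
  by (auto simp: ideal_tensor_eq[OF assms(1)] flux_def four_def minkowski_def power2_eq_square)

text \<open>The minus signs arise because \<open>flux_matrix\<close> refers to covariant components,
  whose time component is \<open>- fst h\<close>.\<close>

lemma flux_has_derivative:
  assumes "\<psi> \<in> state_space" "flux_matrix \<psi> = (K00, K01, K11)"
  defines "s \<equiv> 4 / (3 * msq \<psi> ^ 4)"
  shows "(flux 0 has_derivative (\<lambda>h. s * (K01 * snd h - K00 * fst h))) (at \<psi>)"
    and "(flux 1 has_derivative (\<lambda>h. s * (K11 * snd h - K01 * fst h))) (at \<psi>)"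
proof -
  obtain a b where ab: "\<psi> = (a, b)" by force
  define n where "n = a\<^sup>2 - b\<^sup>2"
  have n: "n > 0" using msq_pos[OF assms(1)] by (simp add: n_def ab)
  \<comment> \<open>With this common factor split off, both derivatives reduce to polynomial
    identities that are multiplied by \<open>r\<close> at the end.\<close>
  define r where "r = 1 / n ^ 4"
  have k: "K00 = b * (5 * a\<^sup>2 + b\<^sup>2)" "K01 = a * (a\<^sup>2 + 5 * b\<^sup>2)" "K11 = 3 * b * (a\<^sup>2 + b\<^sup>2)"
    using assms(2) by (simp_all add: flux_matrix_def ab)
  have dn: "(msq has_derivative (\<lambda>h. 2 * a * fst h - 2 * b * snd h)) (at (a, b))"
    by (auto intro!: derivative_eq_intros simp: algebra_simps)
  have "((\<lambda>t. inverse (t ^ 3)) has_real_derivative - 3 * r) (at n)"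
    using n by (auto intro!: derivative_eq_intros simp: r_def field_simps power_numeral_reduce)
  then have d3: "((\<lambda>\<psi>. inverse (msq \<psi> ^ 3)) has_derivative
     (\<lambda>h. (2 * a * fst h - 2 * b * snd h) * (- 3 * r))) (at (a, b))"
    by (intro DERIV_compose_FDERIV[OF _ dn]) (simp add: n_def)
  have "((\<lambda>t. inverse (t\<^sup>2)) has_real_derivative - 2 * n * r) (at n)"
    using n by (auto intro!: derivative_eq_intros simp: r_def field_simps power_numeral_reduce)
  then have d2: "((\<lambda>\<psi>. inverse ((msq \<psi>)\<^sup>2)) has_derivative
     (\<lambda>h. (2 * a * fst h - 2 * b * snd h) * (- 2 * n * r))) (at (a, b))"
    by (intro DERIV_compose_FDERIV[OF _ dn]) (simp add: n_def)
  have 0: "flux 0 = (\<lambda>\<psi>. 4 / 3 * fst \<psi> * snd \<psi> * inverse (msq \<psi> ^ 3))"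
    by (intro ext) (simp add: flux_def inverse_eq_divide)
  have 1: "flux 1 = (\<lambda>\<psi>. 4 / 3 * (snd \<psi>)\<^sup>2 * inverse (msq \<psi> ^ 3) + 1 / 3 * inverse ((msq \<psi>)\<^sup>2))"
    by (intro ext) (simp add: flux_def inverse_eq_divide)
  have s: "s = 4 / 3 * r" by (simp add: s_def r_def ab n_def)
  have p: "inverse (n ^ 3) = n * r" using n by (simp add: r_def field_simps power_numeral_reduce)
  show "(flux 0 has_derivative (\<lambda>h. s * (K01 * snd h - K00 * fst h))) (at \<psi>)"
    unfolding 0 ab
  proof (rule has_derivative_eq_rhs)
    show "((\<lambda>\<psi>. 4 / 3 * fst \<psi> * snd \<psi> * inverse (msq \<psi> ^ 3)) has_derivative
        (\<lambda>h. 4 / 3 * a * b * ((2 * a * fst h - 2 * b * snd h) * (- 3 * r))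
          + (4 / 3 * a * snd h + 4 / 3 * fst h * b) * (n * r))) (at (a, b))"
      by (rule has_derivative_eq_rhs, (rule derivative_intros d3)+)
        (simp add: p fun_eq_iff flip: n_def)
    show "(\<lambda>h. 4 / 3 * a * b * ((2 * a * fst h - 2 * b * snd h) * (- 3 * r))
          + (4 / 3 * a * snd h + 4 / 3 * fst h * b) * (n * r))
        = (\<lambda>h. s * (K01 * snd h - K00 * fst h))"
    proof
      fix h :: state
      have "4 / 3 * a * b * ((2 * a * fst h - 2 * b * snd h) * - 3)
          + (4 / 3 * a * snd h + 4 / 3 * fst h * b) * n = 4 / 3 * (K01 * snd h - K00 * fst h)"
        by (simp add: k n_def power2_eq_square field_simps)
      from arg_cong[OF this, of "\<lambda>x. x * r"]
      show "4 / 3 * a * b * ((2 * a * fst h - 2 * b * snd h) * (- 3 * r))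
          + (4 / 3 * a * snd h + 4 / 3 * fst h * b) * (n * r) = s * (K01 * snd h - K00 * fst h)"
        by (simp add: s algebra_simps)
    qed
  qed
  show "(flux 1 has_derivative (\<lambda>h. s * (K11 * snd h - K01 * fst h))) (at \<psi>)"
    unfolding 1 ab
  proof (rule has_derivative_eq_rhs)
    show "((\<lambda>\<psi>. 4 / 3 * (snd \<psi>)\<^sup>2 * inverse (msq \<psi> ^ 3) + 1 / 3 * inverse ((msq \<psi>)\<^sup>2)) has_derivative
        (\<lambda>h. 4 / 3 * b\<^sup>2 * ((2 * a * fst h - 2 * b * snd h) * (- 3 * r))
          + 8 / 3 * b * snd h * (n * r)
          + 1 / 3 * ((2 * a * fst h - 2 * b * snd h) * (- 2 * n * r)))) (at (a, b))"
      by (rule has_derivative_eq_rhs, (rule derivative_intros d3 d2)+)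
        (simp add: p fun_eq_iff flip: n_def)
    show "(\<lambda>h. 4 / 3 * b\<^sup>2 * ((2 * a * fst h - 2 * b * snd h) * (- 3 * r))
          + 8 / 3 * b * snd h * (n * r)
          + 1 / 3 * ((2 * a * fst h - 2 * b * snd h) * (- 2 * n * r)))
        = (\<lambda>h. s * (K11 * snd h - K01 * fst h))"
    proof
      fix h :: state
      have "4 / 3 * b\<^sup>2 * ((2 * a * fst h - 2 * b * snd h) * - 3) + 8 / 3 * b * snd h * n
          + 1 / 3 * ((2 * a * fst h - 2 * b * snd h) * (- 2 * n)) = 4 / 3 * (K11 * snd h - K01 * fst h)"
        by (simp add: k n_def power2_eq_square field_simps)
      from arg_cong[OF this, of "\<lambda>x. x * r"]
      show "4 / 3 * b\<^sup>2 * ((2 * a * fst h - 2 * b * snd h) * (- 3 * r))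
          + 8 / 3 * b * snd h * (n * r)
          + 1 / 3 * ((2 * a * fst h - 2 * b * snd h) * (- 2 * n * r)) = s * (K11 * snd h - K01 * fst h)"
        by (simp add: s algebra_simps)
    qed
  qed
qed

subsection \<open>The discriminant\<close>

text \<open>Discriminant of the quadratic polynomial
  $\lambda \mapsto \det (K - \lambda B)$ for symmetric matrices given by their upper triangles.\<close>

definition pencil_disc :: "real \<times> real \<times> real \<Rightarrow> real \<times> real \<times> real \<Rightarrow> real" where
  "pencil_disc B K = (case B of (B00, B01, B11) \<Rightarrow> case K of (K00, K01, K11) \<Rightarrow>
     (B00 * K11 + B11 * K00 - 2 * B01 * K01)\<^sup>2
       - 4 * (B00 * B11 - B01\<^sup>2) * (K00 * K11 - K01\<^sup>2))"

text \<open>The hypothesis \<open>nu\<close> is the prescribed value of \<nu> cleared of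
  denominators; it is what gives det B a third factor 1 - W. The factor 3 W - 1 of det K marks the
  sonic states.\<close>

lemma pencil_disc_eq:
  assumes nu: "9 * \<mu> * \<eta> = \<nu> * (3 * \<mu> - \<eta>)" and W: "W = w\<^sup>2"
  shows "pencil_disc (diss_matrix \<eta> \<mu> \<nu> (1, w)) (flux_matrix (1, w)) =
    (1 - W) ^ 4 * (W * ((9 * \<mu> + 3 * \<nu>) * W - 3 * \<mu> - 4 * \<eta> - \<nu>)\<^sup>2
     - 4 * \<nu> * (\<mu> - 4/3 * \<eta> - 9 * \<mu> * W) * (1 - W) * (3 * W - 1))"
proof -
  define B00 B01 B11 where b: "B00 = 4/3 * \<eta> * W - 16 * \<mu> * W - \<nu> * (1 + W)\<^sup>2"
    "B01 = w * (4/3 * \<eta> - 4 * \<mu> * (1 + 3 * W) - 2 * \<nu> * (1 + W))"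
    "B11 = 4/3 * \<eta> - \<mu> * (1 + 3 * W)\<^sup>2 - 4 * \<nu> * W"
  define K00 K01 K11 where k: "K00 = w * (5 + W)" "K01 = 1 + 5 * W" "K11 = 3 * w * (1 + W)"
  have B: "diss_matrix \<eta> \<mu> \<nu> (1, w) = (B00, B01, B11)"
    by (simp add: diss_matrix_def b W algebra_simps)
  have K: "flux_matrix (1, w) = (K00, K01, K11)"
    by (simp add: flux_matrix_def k W)
  have W': "w * w = W" "w * (w * x) = W * x" for x by (simp_all add: W power2_eq_square)
  have 1: "B00 * K11 + B11 * K00 - 2 * B01 * K01 =
     - w * (1 - W)\<^sup>2 * ((9 * \<mu> + 3 * \<nu>) * W - 3 * \<mu> - 4 * \<eta> - \<nu>)"
    unfolding b k by (simp add: W' power2_eq_square power3_eq_cube algebra_simps add_divide_distrib diff_divide_distrib)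
  have 2: "K00 * K11 - K01\<^sup>2 = (3 * W - 1) * (1 - W)\<^sup>2"
    unfolding k by (simp add: W' power2_eq_square power3_eq_cube algebra_simps add_divide_distrib diff_divide_distrib)
  have 3: "B00 * B11 - B01\<^sup>2 = (1 - W)\<^sup>2 * 
     ((9 * \<mu> * W + \<nu>) * ((\<mu> - 4/3 * \<eta>) + \<nu> * W) - (3 * \<mu> + \<nu>)\<^sup>2 * W)"
    unfolding b by (simp add: W' power2_eq_square power3_eq_cube algebra_simps add_divide_distrib diff_divide_distrib)
  have "(9 * \<mu> * W + \<nu>) * ((\<mu> - 4/3 * \<eta>) + \<nu> * W) - (3 * \<mu> + \<nu>)\<^sup>2 * W
     = \<nu> * (\<mu> - 4/3 * \<eta> - 9 * \<mu> * W) * (1 - W) - 4/3 * W * (9 * \<mu> * \<eta> - \<nu> * (3 * \<mu> - \<eta>))"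
    by (simp add: power2_eq_square field_simps)
  also have "\<dots> = \<nu> * (\<mu> - 4/3 * \<eta> - 9 * \<mu> * W) * (1 - W)" using nu by simp
  finally have 3: "B00 * B11 - B01\<^sup>2 = (1 - W)\<^sup>2 * (\<nu> * (\<mu> - 4/3 * \<eta> - 9 * \<mu> * W) * (1 - W))"
    using 3 by simp
  have "(- w * q\<^sup>2 * R)\<^sup>2 - 4 * (q\<^sup>2 * (\<nu> * M * q)) * (s * q\<^sup>2)
      = q ^ 4 * (w\<^sup>2 * R\<^sup>2 - 4 * \<nu> * M * q * s)" for q R M s
    by (simp add: power2_eq_square power4_eq_xxxx algebra_simps)
  then show ?thesis unfolding B K pencil_disc_def split 1 2 3 by (simp add: W)
qed

lemma ex_pencil_disc_neg:
  assumes pos: "\<eta> > 0" "\<mu> > 0" "\<nu> > 0"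
    and mu: "\<mu> \<ge> 4 / 3 * \<eta>" and nu: "\<nu> = inverse (1 / (3 * \<eta>) - 1 / (9 * \<mu>))"
  obtains w where "w > 0" "1 / 9 < w\<^sup>2" "w\<^sup>2 < 1 / 3"
    "pencil_disc (diss_matrix \<eta> \<mu> \<nu> (1, w)) (flux_matrix (1, w)) < 0"
proof -
  have "1 / (3 * \<eta>) - 1 / (9 * \<mu>) = (3 * \<mu> - \<eta>) / (9 * \<mu> * \<eta>)"
    using pos by (simp add: field_simps)
  then have "\<nu> = 9 * \<mu> * \<eta> / (3 * \<mu> - \<eta>)" using nu by simp
  then have nu: "9 * \<mu> * \<eta> = \<nu> * (3 * \<mu> - \<eta>)" using mu pos by simp
  then have "(3 * \<eta>) * (3 * \<mu>) = \<nu> * (3 * \<mu>) - \<nu> * \<eta>" by (simp add: algebra_simps)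
  then have "(3 * \<eta>) * (3 * \<mu>) < \<nu> * (3 * \<mu>)" using pos by simp
  \<comment> \<open>From 9 \<mu> \<eta> = \<nu> (3 \<mu> - \<eta>) < 3 \<mu> \<nu>; this bound
    decides the final sign.\<close>
  then have nu3: "\<nu> > 3 * \<eta>" using pos by (simp only: mult_less_cancel_right)
  txt \<open>For large $\mu$ the discriminant is $\frac13(x-4)^2\eta^2$ to leading order, where
    $x\eta = (3\mu+\nu)\epsilon$; hence the choice of the double root.\<close>
  define \<epsilon> where "\<epsilon> = 4 * \<eta> / (3 * \<mu> + \<nu>)"
  have eps: "(3 * \<mu> + \<nu>) * \<epsilon> = 4 * \<eta>" using pos by (simp add: \<epsilon>_def)
  have eps0: "\<epsilon> > 0" using pos by (simp add: \<epsilon>_def)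
  \<comment> \<open>Here 3 \<mu> + \<nu> > 7 \<eta>, so even \<epsilon> < 4/7; the value 2/3 is what
    W > 1/9 requires.\<close>
  have eps1: "\<epsilon> < 2 / 3" using pos mu nu3 by (simp add: \<epsilon>_def field_simps)
  define W where "W = (1 - \<epsilon>) / 3"
  have W: "1 / 9 < W" "W < 1 / 3" using eps0 eps1 by (simp_all add: W_def)
  have br: "(9 * \<mu> + 3 * \<nu>) * W - 3 * \<mu> - 4 * \<eta> - \<nu> = - 8 * \<eta>"
    using eps by (simp add: W_def field_simps)
  \<comment> \<open>Eliminates \<mu>. After that the terms of order zero and one in \<epsilon>
    cancel, and a negative multiple of \<epsilon>^2 remains.\<close>
  have n1: "\<nu> * \<epsilon> * \<mu> = 4 * \<eta>\<^sup>2 - 2 / 3 * \<eta> * (\<nu> * \<epsilon>)"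
  proof -
    have "\<nu> * (2 * \<mu> + 4 / 3 * \<eta>) = 2 * \<eta> * (3 * \<mu> + \<nu>)" using nu by (simp add: algebra_simps)
    then have "\<nu> * (2 * \<mu> + 4 / 3 * \<eta>) * \<epsilon> = 2 * \<eta> * (4 * \<eta>)" using eps by (metis mult.assoc)
    then show ?thesis by (simp add: power2_eq_square algebra_simps)
  qed
  have "W * (- 8 * \<eta>)\<^sup>2 - 4 * \<nu> * (\<mu> - 4/3 * \<eta> - 9 * \<mu> * W) * (1 - W) * (3 * W - 1)
     = 4 / 3 * (16 * \<eta>\<^sup>2 * (1 - \<epsilon>) - (2 + \<epsilon>) * (2 * (\<nu> * \<epsilon> * \<mu>) + 4 / 3 * \<eta> * (\<nu> * \<epsilon>) - 3 * (\<nu> * \<epsilon> * \<mu>) * \<epsilon>))"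
    by (simp add: W_def power2_eq_square field_simps)
  also have "\<dots> = - 4 * \<epsilon>\<^sup>2 * \<eta> * (2 / 3 * \<epsilon> * \<nu> + 4 / 3 * \<nu> - 4 * \<eta>)"
    unfolding n1 by (simp add: power2_eq_square field_simps)
  also have "\<dots> < 0"
  proof -
    have "0 < \<epsilon> * \<nu>" using pos eps0 by simp
    then have "2 / 3 * \<epsilon> * \<nu> + 4 / 3 * \<nu> - 4 * \<eta> > 0" using nu3 by simp
    then show ?thesis using pos eps0 by simp
  qed
  finally have neg: "W * (- 8 * \<eta>)\<^sup>2 - 4 * \<nu> * (\<mu> - 4/3 * \<eta> - 9 * \<mu> * W) * (1 - W) * (3 * W - 1) < 0" .
  have w: "sqrt W > 0" "(sqrt W)\<^sup>2 = W" using W by simp_all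
  have "pencil_disc (diss_matrix \<eta> \<mu> \<nu> (1, sqrt W)) (flux_matrix (1, sqrt W)) < 0"
    unfolding pencil_disc_eq[OF nu w(2)[symmetric]] br using neg W by (simp add: mult_less_0_iff zero_less_power)
  then show thesis using that[OF w(1)] W w(2) by simp
qed

subsection \<open>Shocks and profiles\<close>

text \<open>Where B is invertible the implicit profile equation becomes an ordinary differential
  equation with field \<open>F\<close>. In covariant components its linearisation at the right state
  is a positive multiple of B^{-1} K, so a negative discriminant means a focus.\<close>

lemma shock_profile_oscillatory:
  assumes profile: "shock_profile \<eta> \<mu> \<nu> \<psi>m \<psi>p \<phi>"
    and states: "\<psi>m \<in> state_space" "\<psi>p \<in> state_space" "\<psi>m \<noteq> \<psi>p"
    and rh: "rankine_hugoniot \<psi>m \<psi>p"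
    and disc: "pencil_disc (diss_matrix \<eta> \<mu> \<nu> \<psi>p) (flux_matrix \<psi>p) < 0"
  shows "oscillatory \<phi>"
proof -
  define B00 where "B00 x = fst (diss_matrix \<eta> \<mu> \<nu> x)" for x
  define B01 where "B01 x = fst (snd (diss_matrix \<eta> \<mu> \<nu> x))" for x
  define B11 where "B11 x = snd (snd (diss_matrix \<eta> \<mu> \<nu> x))" for x
  have B: "diss_matrix \<eta> \<mu> \<nu> x = (B00 x, B01 x, B11 x)" for x
    by (simp add: B00_def B01_def B11_def)
  have contB: "continuous_on UNIV B00" "continuous_on UNIV B01" "continuous_on UNIV B11"
    unfolding B00_def B01_def B11_def diss_matrix_def Let_def fst_conv snd_conv
    by (intro continuous_intros)+
  define D where "D x = B00 x * B11 x - (B01 x)\<^sup>2" for x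
  have contD: "continuous_on UNIV D" unfolding D_def by (intro continuous_intros contB)
  \<comment> \<open>B may be singular elsewhere on the profile; outside \<open>N\<close> only
    continuity of the profile is used.\<close>
  define N where "N = state_space \<inter> {x. D x \<noteq> 0}"
  have N: "open N" unfolding N_def
    by (intro open_Int open_state_space open_Collect_neq contD continuous_intros)
  obtain K00 K01 K11 where K: "flux_matrix \<psi>p = (K00, K01, K11)" by (cases "flux_matrix \<psi>p")
  define G where "G \<alpha> x = flux \<alpha> x - flux \<alpha> \<psi>p" for \<alpha> x
  \<comment> \<open>Cramer's rule: \<open>c\<close> combines the inverse determinant with the factor
    that \<open>B_diss_eq\<close> splits off.\<close>
  define c where "c x = (msq x)\<^sup>2 / D x" for x
  define F where "F x = ((- c x * B11 x) * G 0 x + (c x * B01 x) * G 1 x,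
     (- c x * B01 x) * G 0 x + (c x * B00 x) * G 1 x)" for x :: state
  define s where "s = 4 / (3 * msq \<psi>p ^ 4)"
  define DG0 where "DG0 h = s * (K01 * snd h - K00 * fst h)" for h :: state
  define DG1 where "DG1 h = s * (K11 * snd h - K01 * fst h)" for h :: state
  define C b0 b1 b2 where "C = c \<psi>p" "b0 = B00 \<psi>p" "b1 = B01 \<psi>p" "b2 = B11 \<psi>p"
  note C = this
  define A where "A h = ((- C * b2) * DG0 h + (C * b1) * DG1 h,
     (- C * b1) * DG0 h + (C * b0) * DG1 h)" for h
  define k where "k = C * s"
  \<comment> \<open>Trace and determinant of \<open>A\<close>, so that t^2 - 4 d is k^2 times the
    discriminant of the pencil.\<close>
  define t where "t = k * (b0 * K11 + b2 * K00 - 2 * b1 * K01)"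
  define d where "d = k\<^sup>2 * ((b0 * b2 - b1\<^sup>2) * (K00 * K11 - K01\<^sup>2))"
  have disc': "(b0 * K11 + b2 * K00 - 2 * b1 * K01)\<^sup>2
      - 4 * (b0 * b2 - b1\<^sup>2) * (K00 * K11 - K01\<^sup>2) < 0"
    using disc by (simp add: pencil_disc_def B K C)
  \<comment> \<open>If det B were zero, the discriminant would be a square.\<close>
  have D0: "D \<psi>p \<noteq> 0"
  proof
    assume "D \<psi>p = 0"
    then have "b0 * b2 - b1\<^sup>2 = 0" by (simp add: D_def C)
    then show False using disc' zero_le_power2 by (simp add: not_less[symmetric])
  qed
  then have pN: "\<psi>p \<in> N" using states by (simp add: N_def)
  have msq: "msq x > 0" if "x \<in> N" for x using that msq_pos by (simp add: N_def)
  have "k \<noteq> 0" using msq[OF pN] D0 by (simp add: k_def C s_def c_def)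
  then have neg: "k\<^sup>2 * ((b0 * K11 + b2 * K00 - 2 * b1 * K01)\<^sup>2
      - 4 * (b0 * b2 - b1\<^sup>2) * (K00 * K11 - K01\<^sup>2)) < 0"
    using disc' by (simp add: mult_less_0_iff)
  have td: "t\<^sup>2 < 4 * d"
  proof -
    have "x * (u - 4 * v * y) = x * u - 4 * (x * (v * y))" for x u v y :: real
      by (simp add: algebra_simps)
    from this[of "k\<^sup>2"] show ?thesis
      using neg by (simp only: t_def d_def power_mult_distrib)
  qed
  have AA: "A (A h) = t *\<^sub>R A h - d *\<^sub>R h" for h
    by (cases h) (simp add: A_def DG0_def DG1_def t_def d_def k_def power2_eq_square algebra_simps)
  have ic: "isCont f \<psi>p" if "continuous_on UNIV f" for f :: "state \<Rightarrow> real"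
    using that continuous_on_eq_continuous_at[OF open_UNIV] by blast
  have contc: "isCont c \<psi>p" unfolding c_def
    by (intro continuous_intros ic contD D0)
  note G' = flux_has_derivative[OF states(2) K, folded s_def, folded DG0_def DG1_def]
  have G: "(G 0 has_derivative DG0) (at \<psi>p)" "G 0 \<psi>p = 0"
     "(G 1 has_derivative DG1) (at \<psi>p)" "G 1 \<psi>p = 0"
    unfolding G_def [abs_def] using has_derivative_diff[OF G'(1) has_derivative_const]
      has_derivative_diff[OF G'(2) has_derivative_const] by simp_all
  have F': "(F has_derivative A) (at \<psi>p)"
    unfolding F_def [abs_def] A_def [abs_def] C
    by (intro has_derivative_Pair has_derivative_add has_derivative_mult_at_zero G
        continuous_intros contc ic contB)
  have F0: "F \<psi>p = 0" by (simp only: F_def G mult_zero_right add_0 zero_prod_def)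
  have in_S: "\<phi> z \<in> state_space" for z using profile by (simp add: shock_profile_def)
  have solve: "\<exists>v. (\<phi> has_vector_derivative v) (at z) \<and> (\<phi> z \<in> N \<longrightarrow> v = F (\<phi> z))" for z
  proof -
    let ?x = "\<phi> z"
    obtain v where v: "(\<phi> has_vector_derivative v) (at z)"
      and eq: "\<And>\<alpha>. \<alpha> < 2 \<Longrightarrow> (\<Sum>\<gamma><2. B_diss \<eta> \<mu> \<nu> ?x \<alpha> 1 \<gamma> 1 * lower (four v) \<gamma>)
               = ideal_tensor ?x \<alpha> 1 - ideal_tensor \<psi>m \<alpha> 1"
      using profile unfolding shock_profile_def by blast
    \<comment> \<open>Rankine-Hugoniot moves the reference state from left to right, so that the
      field vanishes at the right state.\<close>
    have T: "ideal_tensor ?x \<alpha> 1 - ideal_tensor \<psi>m \<alpha> 1 = G \<alpha> ?x" if "\<alpha> < 2" for \<alpha>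
      using rh that ideal_tensor_flux[OF in_S that] ideal_tensor_flux[OF states(2) that]
      by (simp add: rankine_hugoniot_def G_def)
    have low: "lower (four v) 0 = - fst v" "lower (four v) (Suc 0) = snd v"
      by (simp_all add: lower_def sum_lessThan_4 minkowski_def four_def)
    note Bd = B_diss_eq[OF in_S B, of z, simplified]
    have e0: "(B01 ?x * snd v - B00 ?x * fst v) / (msq ?x)\<^sup>2 = G 0 ?x"
      using eq[of 0] T[of 0] by (simp add: sum_lessThan_2 low Bd diff_divide_distrib)
    have e1: "(B11 ?x * snd v - B01 ?x * fst v) / (msq ?x)\<^sup>2 = G 1 ?x"
      using eq[of 1] T[of 1] by (simp add: sum_lessThan_2 low Bd diff_divide_distrib)
    have "v = F ?x" if x: "?x \<in> N"
    proof (rule prod_eqI)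
      have m: "(msq ?x)\<^sup>2 \<noteq> 0" "D ?x \<noteq> 0" using msq[OF x] x by (auto simp: N_def)
      have e: "B01 ?x * snd v - B00 ?x * fst v = (msq ?x)\<^sup>2 * G 0 ?x"
        "B11 ?x * snd v - B01 ?x * fst v = (msq ?x)\<^sup>2 * G 1 ?x"
        using e0 e1 m(1) by (simp_all add: nonzero_divide_eq_eq mult.commute)
      have "D ?x * fst v = B01 ?x * ((msq ?x)\<^sup>2 * G 1 ?x) - B11 ?x * ((msq ?x)\<^sup>2 * G 0 ?x)"
        unfolding e[symmetric] by (simp add: D_def power2_eq_square algebra_simps)
      then have "fst v = (B01 ?x * ((msq ?x)\<^sup>2 * G 1 ?x) - B11 ?x * ((msq ?x)\<^sup>2 * G 0 ?x)) / D ?x"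
        using m(2) by (simp add: nonzero_eq_divide_eq mult.commute)
      then show "fst v = fst (F ?x)" by (simp add: F_def c_def diff_divide_distrib mult_ac)
      have "D ?x * snd v = B00 ?x * ((msq ?x)\<^sup>2 * G 1 ?x) - B01 ?x * ((msq ?x)\<^sup>2 * G 0 ?x)"
        unfolding e[symmetric] by (simp add: D_def power2_eq_square algebra_simps)
      then have "snd v = (B00 ?x * ((msq ?x)\<^sup>2 * G 1 ?x) - B01 ?x * ((msq ?x)\<^sup>2 * G 0 ?x)) / D ?x"
        using m(2) by (simp add: nonzero_eq_divide_eq mult.commute)
      then show "snd v = snd (F ?x)" by (simp add: F_def c_def diff_divide_distrib mult_ac)
    qed
    with v show ?thesis by blast
  qed
  have cont: "continuous_on UNIV \<phi>"
    using solve by (meson continuous_at_imp_continuous_on has_vector_derivative_continuous)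
  have lim: "(\<phi> \<longlongrightarrow> \<psi>m) at_bot" "(\<phi> \<longlongrightarrow> \<psi>p) at_top"
    using profile by (simp_all add: shock_profile_def)
  have "N \<subseteq> state_space" by (simp add: N_def)
  moreover have "(\<phi> has_vector_derivative F (\<phi> z)) (at z)" if "\<phi> z \<in> N" for z
    using solve[of z] that by metis
  ultimately show ?thesis
    by (rule focus_oscillatory[OF cont lim states(3) N pN _ _ F0 F' AA td])
qed

section \<open>Shocks with a prescribed right state\<close>

text \<open>At speed w the quotient T^{11} / T^{01} is (1 + 3 w^2) / (4 w), which takes equal values
  at two speeds with product 1/3. This gives the left speed 1 / (3 w), below 1 since w^2 > 1/9. The
  scale \<kappa> is then fixed by T^{01}, which is homogeneous of degree -4.\<close>

lemma ex_conjugate_state: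
  assumes w: "w > 0" "1 / 9 < w\<^sup>2" "w\<^sup>2 < 1"
  obtains \<kappa> where "\<kappa> > 0" "rankine_hugoniot (\<kappa>, \<kappa> / (3 * w)) (1, w)"
proof -
  define m where "m = 1 - 1 / (9 * w\<^sup>2)"
  have m: "m > 0" using w by (simp add: m_def field_simps)
  \<comment> \<open>The value of \<kappa>^4 that solves the equation for T^{01}.\<close>
  define X where "X = (1 - w\<^sup>2) ^ 3 / (3 * w\<^sup>2 * m ^ 3)"
  have X: "X > 0" using w m by (simp add: X_def)
  define \<kappa> where "\<kappa> = root 4 X"
  have \<kappa>: "\<kappa> > 0" "\<kappa> ^ 4 = X" using X by (simp_all add: \<kappa>_def)
  have 3: "3 * w > 1"
    using w by (intro power2_less_imp_less[of 1 "3 * w"]) (auto simp: power_mult_distrib)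
  have st: "(\<kappa>, \<kappa> / (3 * w)) \<in> state_space" "(1, w) \<in> state_space"
    using w \<kappa>(1) 3 by (auto simp: state_space_def abs_square_less_1 field_simps)
  have q: "msq (\<kappa>, \<kappa> / (3 * w)) = \<kappa>\<^sup>2 * m" using w by (simp add: m_def power_divide power_mult_distrib field_simps)
  have key: "\<kappa> ^ 4 * m ^ 3 * (3 * w\<^sup>2) = (1 - w\<^sup>2) ^ 3" using w m by (simp add: \<kappa>(2) X_def)
  have p: "1 - w\<^sup>2 > 0" using w by simp
  have k6: "(\<kappa>\<^sup>2 * m) ^ 3 = \<kappa>\<^sup>2 * (\<kappa> ^ 4 * m ^ 3)" "(\<kappa>\<^sup>2 * m) ^ 2 = \<kappa> ^ 4 * m\<^sup>2"
    by (simp_all add: power_mult_distrib flip: power_mult power_add)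
  have km: "\<kappa> ^ 4 * m ^ 3 = (1 - w\<^sup>2) ^ 3 / (3 * w\<^sup>2)" using key w by (simp add: field_simps)
  have "flux 0 (\<kappa>, \<kappa> / (3 * w)) = flux 0 (1, w)"
    unfolding flux_def q k6 km using \<kappa>(1) w p by (simp add: power2_eq_square)
  moreover have "flux 1 (\<kappa>, \<kappa> / (3 * w)) = flux 1 (1, w)"
  proof -
    have "1 / (3 * (\<kappa> ^ 4 * m\<^sup>2)) = m / (3 * (\<kappa> ^ 4 * m ^ 3))"
      using \<kappa>(1) m by (simp add: power2_eq_square power3_eq_cube)
    then have "flux 1 (\<kappa>, \<kappa> / (3 * w)) = (4 / (9 * w\<^sup>2) + m) / (3 * (\<kappa> ^ 4 * m ^ 3))"
      unfolding flux_def q k6 using \<kappa>(1) w m by (simp add: power2_eq_square add_divide_distrib)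
    also have "\<dots> = (1 + 3 * w\<^sup>2) / (3 * (1 - w\<^sup>2) ^ 3)"
      unfolding km using w p by (simp add: m_def field_simps)
    also have "\<dots> = 4 / 3 * w\<^sup>2 / (1 - w\<^sup>2) ^ 3 + (1 - w\<^sup>2) / (3 * (1 - w\<^sup>2) ^ 3)"
      using p by (simp add: field_simps)
    also have "\<dots> = flux 1 (1, w)"
      using p by (simp add: flux_def power2_eq_square power3_eq_cube)
    finally show ?thesis .
  qed
  ultimately have "rankine_hugoniot (\<kappa>, \<kappa> / (3 * w)) (1, w)"
    using ideal_tensor_flux[OF st(1)] ideal_tensor_flux[OF st(2)]
    by (simp add: rankine_hugoniot_def all_less_2)
  with \<kappa>(1) show thesis by (rule that)
qed

text \<open>The sign of \<open>char_speed1\<close> is that of fluid speed minus sound speed. The two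
  speeds have product c^2 and so lie on opposite sides of c: supersonic left, subsonic right, which
  is the first Lax alternative.\<close>

lemma ex_lax_shock:
  assumes w: "w > 0" "1 / 9 < w\<^sup>2" "w\<^sup>2 < 1 / 3"
  obtains \<psi>m where "(\<psi>m, (1, w)) \<in> lax_shocks"
proof -
  have w1: "w\<^sup>2 < 1" using w by simp
  obtain \<kappa> where \<kappa>: "\<kappa> > 0" "rankine_hugoniot (\<kappa>, \<kappa> / (3 * w)) (1, w)"
    using ex_conjugate_state[OF w(1,2) w1] by blast
  have c: "sound_speed > 0" "sound_speed\<^sup>2 = 1 / 3" by (simp_all add: sound_speed_def power_divide)
  have wc: "w < sound_speed"
    using w c by (intro power2_less_imp_less[of w]) auto
  have c1: "sound_speed < 1" using c by (intro power2_less_imp_less[of _ 1]) auto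
  have w3: "1 / 3 < w" using w by (intro power2_less_imp_less[of _ w]) (auto simp: power_divide)
  have cw: "sound_speed < 1 / (3 * w)"
  proof -
    have "sound_speed * w < sound_speed * sound_speed" using wc c by simp
    also have "\<dots> = 1 / 3" using c by (simp add: power2_eq_square)
    finally show ?thesis using w by (simp add: field_simps)
  qed
  have st: "(\<kappa>, \<kappa> / (3 * w)) \<in> state_space" "(1, w) \<in> state_space"
    using w3 wc c1 \<kappa>(1) by (auto simp: state_space_def field_simps)
  have speeds: "fluid_speed (\<kappa>, \<kappa> / (3 * w)) = 1 / (3 * w)" "fluid_speed (1, w) = w"
    using \<kappa>(1) by (simp_all add: fluid_speed_eq[OF st(1)] fluid_speed_eq[OF st(2)])
  have less1: "x * sound_speed < 1" if "0 < x" "x < 1" for x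
    using that c c1 mult_strict_mono[of x 1 sound_speed 1] by simp
  have "lax_entropy (\<kappa>, \<kappa> / (3 * w)) (1, w)"
  proof -
    have "char_speed1 (\<kappa>, \<kappa> / (3 * w)) > 0"
      unfolding char_speed1_def speeds using cw less1[of "1 / (3 * w)"] w3 by (simp add: field_simps)
    moreover have "char_speed1 (1, w) < 0"
      unfolding char_speed1_def speeds using wc less1[of w] w c1 by (simp add: divide_neg_pos)
    moreover have "char_speed2 (1, w) > 0"
      unfolding char_speed2_def speeds using w c by (simp add: add_pos_pos)
    ultimately show ?thesis by (simp add: lax_entropy_def)
  qed
  moreover have "(\<kappa>, \<kappa> / (3 * w)) \<noteq> (1, w)"
    using wc cw by auto
  ultimately have "((\<kappa>, \<kappa> / (3 * w)), (1, w)) \<in> lax_shocks"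
    using \<kappa>(2) st by (simp add: lax_shocks_def)
  then show thesis by (rule that)
qed

theorem theorem1:
  fixes \<eta> \<mu> \<nu> :: real
  assumes "\<eta> > 0" and "\<mu> > 0" and "\<nu> > 0"
    and "\<mu> \<ge> 4 / 3 * \<eta>"
    and "\<nu> = inverse (1 / (3 * \<eta>) - 1 / (9 * \<mu>))"
  shows "\<exists>S. S \<noteq> {} \<and> openin (top_of_set lax_shocks) S \<and>
    (\<forall>(\<psi>m, \<psi>p) \<in> S.
       (\<exists>\<phi>. shock_profile \<eta> \<mu> \<nu> \<psi>m \<psi>p \<phi> \<and> oscillatory \<phi>) \<or>
       \<not> (\<exists>\<phi>. shock_profile \<eta> \<mu> \<nu> \<psi>m \<psi>p \<phi>))"
proof -
  \<comment> \<open>A range of shocks is understood as a nonempty relatively open set of them. The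
    condition concerns the right state alone and is open because the matrix entries are
    polynomials.\<close>
  define Q where "Q = {s :: state \<times> state. pencil_disc (diss_matrix \<eta> \<mu> \<nu> (snd s)) (flux_matrix (snd s)) < 0}"
  have "open Q"
    unfolding Q_def pencil_disc_def diss_matrix_def flux_matrix_def Let_def prod.case
    by (intro open_Collect_less continuous_intros)
  then have "openin (top_of_set lax_shocks) (lax_shocks \<inter> Q)" by (rule openin_open_Int)
  moreover have "lax_shocks \<inter> Q \<noteq> {}"
  proof -
    obtain w where w: "w > 0" "1 / 9 < w\<^sup>2" "w\<^sup>2 < 1 / 3"
      "pencil_disc (diss_matrix \<eta> \<mu> \<nu> (1, w)) (flux_matrix (1, w)) < 0"
      using ex_pencil_disc_neg[OF assms] by blast
    obtain \<psi>m where "(\<psi>m, (1, w)) \<in> lax_shocks" using ex_lax_shock[OF w(1-3)] by blast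
    then have "(\<psi>m, (1, w)) \<in> lax_shocks \<inter> Q" using w(4) by (simp add: Q_def)
    then show ?thesis by blast
  qed
  \<comment> \<open>Every profile of such a shock oscillates, so the alternative follows whether or
    not a profile exists.\<close>
  moreover have "oscillatory \<phi>"
    if "(\<psi>m, \<psi>p) \<in> lax_shocks \<inter> Q" "shock_profile \<eta> \<mu> \<nu> \<psi>m \<psi>p \<phi>" for \<psi>m \<psi>p \<phi>
    using shock_profile_oscillatory[OF that(2)] that(1) by (auto simp: lax_shocks_def Q_def)
  ultimately show ?thesis by (intro exI[of _ "lax_shocks \<inter> Q"]) blast
qed

end
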